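(* Let $\Gamma$ be an $n$-vertex graph in $\mathcal{G}(\theta_0,\theta_1,\theta_2)$, where $\theta_0>\theta_1>\theta_2$, such that its complement $\overline{\Gamma}$ is in $\mathcal{G}(\theta_0',\theta_1',\theta_2')$, where $\theta_0'>\theta_1'>\theta_2'$. Then $\Gamma$ is biregular and its two valencies $k_1$ and $k_2$ are $$k_1,k_2=\frac{n+\theta_1+\theta_2\pm\sqrt{(n+\theta_1+\theta_2+2\theta_1\theta_2)^2-4\theta_2^2(\theta_1+1)^2}}{2}.$$ Moreover, $$n=\frac{(\theta_0-\theta_1)^2}{\theta_0-\theta_1+\theta_1\theta_2+\theta_2},\qquad \theta_0=\frac{n}{2}+\theta_1\pm\frac{\sqrt{n(n+4\theta_2(\theta_1+1))}}{2}\ \text{ (for one of the two choices of sign)},$$ $$\theta_0'=n-1-\theta_0+\theta_1-\theta_2,\qquad \theta_1'=-1-\theta_2,\qquad \theta_2'=-1-\theta_1.$$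
   Context: All graphs are finite and simple; eigenvalues of a graph are those of its adjacency matrix. For $\theta_0 > \theta_1 > \theta_2$, $\mathcal{G}(\theta_0,\theta_1,\theta_2)$ denotes the set of connected nonregular graphs having precisely three distinct eigenvalues $\theta_0$, $\theta_1$, $\theta_2$. A graph is biregular if it has precisely two distinct valencies (degrees). *)

theory Defs
  imports
    "Graph_Theory.Graph_Theory"
    "Jordan_Normal_Form.Char_Poly"
begin

text \<open>
  A finite simple graph is a \<open>pair_graph\<close>: a finite vertex set together with a symmetric
  irreflexive set of arcs, so each edge is represented by its two opposite arcs and the valency of
  a vertex is its out-degree.
\<close>

definition valencies :: "'a pair_pre_digraph \<Rightarrow> nat set" where
  "valencies G = out_degree (with_proj G) ` pverts G"

definition regular :: "'a pair_pre_digraph \<Rightarrow> bool" where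
  "regular G \<longleftrightarrow> (\<exists>k. \<forall>v \<in> pverts G. out_degree (with_proj G) v = k)"

definition biregular :: "'a pair_pre_digraph \<Rightarrow> bool" where
  "biregular G \<longleftrightarrow> card (valencies G) = 2"

definition complement :: "'a pair_pre_digraph \<Rightarrow> 'a pair_pre_digraph" where
  "complement G = \<lparr> pverts = pverts G,
     parcs = {(u, v). u \<in> pverts G \<and> v \<in> pverts G \<and> u \<noteq> v \<and> (u, v) \<notin> parcs G} \<rparr>"

definition adjacency_matrix :: "'a pair_pre_digraph \<Rightarrow> 'a list \<Rightarrow> real mat" where
  "adjacency_matrix G vs = mat (length vs) (length vs)
     (\<lambda>(i, j). if (vs ! i, vs ! j) \<in> parcs G then 1 else 0)"

text \<open>
  Writing down the adjacency matrix requires an enumeration \<open>vs\<close> of the vertices; the eigenvalues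
  do not depend on it (\<open>graph_eigenvalue_iff\<close> below). The matrix is real symmetric, so it has no
  eigenvalues outside the reals.
\<close>

definition graph_eigenvalue :: "'a pair_pre_digraph \<Rightarrow> real \<Rightarrow> bool" where
  "graph_eigenvalue G \<theta> \<longleftrightarrow>
     (\<exists>vs. distinct vs \<and> set vs = pverts G \<and> eigenvalue (adjacency_matrix G vs) \<theta>)"

text \<open>The set of graphs $\mathcal{G}(\theta_0,\theta_1,\theta_2)$, for vertices of type \<open>'a\<close>.
  The name \<open>connected\<close> alone would be ambiguous with topological connectedness.\<close>

definition three_eigenvalue_graphs :: "real \<Rightarrow> real \<Rightarrow> real \<Rightarrow> 'a pair_pre_digraph set" where
  "three_eigenvalue_graphs \<theta>\<^sub>0 \<theta>\<^sub>1 \<theta>\<^sub>2 =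
     {G. pair_graph G \<and> Digraph_Component.connected (with_proj G) \<and> \<not> regular G \<and>
         {\<theta>. graph_eigenvalue G \<theta>} = {\<theta>\<^sub>0, \<theta>\<^sub>1, \<theta>\<^sub>2}}"

lemma eigenvalue_adjacency_matrix_iff:
  assumes "distinct vs"
  shows "eigenvalue (adjacency_matrix G vs) \<theta> \<longleftrightarrow>
    (\<exists>x. (\<exists>v \<in> set vs. x v \<noteq> 0) \<and>
      (\<forall>u \<in> set vs. (\<Sum>v \<in> set vs. if (u, v) \<in> parcs G then x v else 0) = \<theta> * x u))"
    (is "?L \<longleftrightarrow> ?R")
proof -
  define n where "n = length vs"
  define A where "A = adjacency_matrix G vs"
  have dim: "dim_row A = n" "dim_col A = n"
    by (auto simp: A_def adjacency_matrix_def n_def)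
  have bij: "bij_betw ((!) vs) {0..<n} (set vs)"
    using assms by (intro bij_betw_nth) (auto simp: n_def)
  have mult: "(A *\<^sub>v y) $ i
      = (\<Sum>v \<in> set vs. if (vs ! i, v) \<in> parcs G then x v else 0)"
    if i: "i < n" and y: "y \<in> carrier_vec n" and xy: "\<And>j. j < n \<Longrightarrow> y $ j = x (vs ! j)"
    for i y and x :: "'a \<Rightarrow> real"
  proof -
    have "(A *\<^sub>v y) $ i = (\<Sum>j = 0..<n. A $$ (i, j) * y $ j)"
      using i y dim by (auto simp: scalar_prod_def intro!: sum.cong)
    also have "\<dots> = (\<Sum>j = 0..<n. if (vs ! i, vs ! j) \<in> parcs G then x (vs ! j) else 0)"
      using i xy by (intro sum.cong) (auto simp: A_def adjacency_matrix_def n_def)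
    also have "\<dots> = (\<Sum>v \<in> set vs. if (vs ! i, v) \<in> parcs G then x v else 0)"
      by (rule sum.reindex_bij_betw[OF bij])
    finally show ?thesis .
  qed
  show ?thesis
  proof
    assume ?L
    then obtain y where y: "y \<in> carrier_vec n" "y \<noteq> 0\<^sub>v n" "A *\<^sub>v y = \<theta> \<cdot>\<^sub>v y"
      unfolding eigenvalue_def eigenvector_def using dim by (auto simp: A_def)
    define x where "x v = y $ (the_inv_into {0..<n} ((!) vs) v)" for v
    have x: "y $ j = x (vs ! j)" if "j < n" for j
      using that bij by (simp add: x_def the_inv_into_f_f bij_betw_def)
    have "\<exists>i < n. y $ i \<noteq> 0"
    proof (rule ccontr)
      assume "\<not> ?thesis"
      then have "y = 0\<^sub>v n" using y(1) by (intro eq_vecI) auto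
      with y(2) show False by contradiction
    qed
    then obtain i where i: "i < n" "y $ i \<noteq> 0" by blast
    show ?R
    proof (intro exI[of _ x] conjI ballI)
      show "\<exists>v \<in> set vs. x v \<noteq> 0" using i x by (auto simp: n_def intro!: bexI[of _ "vs ! i"])
      fix u assume "u \<in> set vs"
      then obtain k where k: "k < n" "u = vs ! k" by (auto simp: in_set_conv_nth n_def)
      show "(\<Sum>v \<in> set vs. if (u, v) \<in> parcs G then x v else 0) = \<theta> * x u"
        using mult[OF k(1) y(1) x] y k x by simp
    qed
  next
    assume ?R
    then obtain x v where x: "v \<in> set vs" "x v \<noteq> 0"
      "\<And>u. u \<in> set vs \<Longrightarrow> (\<Sum>v \<in> set vs. if (u, v) \<in> parcs G then x v else 0) = \<theta> * x u" by blast
    define y where "y = vec n (\<lambda>j. x (vs ! j))"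
    have y: "y \<in> carrier_vec n" "\<And>j. j < n \<Longrightarrow> y $ j = x (vs ! j)" by (auto simp: y_def)
    obtain k where k: "k < n" "v = vs ! k" using x(1) by (auto simp: in_set_conv_nth n_def)
    have "y \<noteq> 0\<^sub>v n"
    proof
      assume "y = 0\<^sub>v n"
      then have "y $ k = 0" using k(1) by simp
      with y(2)[OF k(1)] k(2) x(2) show False by simp
    qed
    moreover have "A *\<^sub>v y = \<theta> \<cdot>\<^sub>v y"
      by (rule eq_vecI) (use dim y x mult[OF _ y] in \<open>auto simp: n_def\<close>)
    ultimately show ?L unfolding eigenvalue_def eigenvector_def using y dim by (auto simp: A_def)
  qed
qed

lemma graph_eigenvalue_iff:
  assumes "distinct vs" "set vs = pverts G"
  shows "graph_eigenvalue G \<theta> \<longleftrightarrow> eigenvalue (adjacency_matrix G vs) \<theta>"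
proof -
  have "eigenvalue (adjacency_matrix G ws) \<theta> \<longleftrightarrow> eigenvalue (adjacency_matrix G vs) \<theta>"
    if "distinct ws" "set ws = pverts G" for ws
    using that assms by (simp only: eigenvalue_adjacency_matrix_iff)
  then show ?thesis using assms unfolding graph_eigenvalue_def by blast
qed

end

theory Submission
  imports Defs "HOL-Analysis.Function_Topology"
begin

text \<open>
  Work with functions on the vertex set; \<open>A\<close> and \<open>B\<close> are the adjacency operators of
  \<open>\<Gamma>\<close> and its complement, so \<open>A + B = J - I\<close>. An eigenvector of \<open>A\<close> orthogonal to the
  all-ones vector, for the eigenvalue \<open>t\<close>, is one of \<open>B\<close> for \<open>-1 - t\<close>, while \<open>t\<close> and \<open>-1 - t\<close>
  cannot both be main (that is, have an eigenvector not orthogonal to the all-ones vector).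
  Comparing the main eigenvalues of both graphs shows that \<open>\<theta>\<^sub>1\<close> is not main
  and that \<open>\<theta>\<^sub>1' = -1 - \<theta>\<^sub>2\<close>, \<open>\<theta>\<^sub>2' = -1 - \<theta>\<^sub>1\<close>. Otherwise all eigenvalues are main, which
  forces \<open>n \<le> 3\<close>; or \<open>A\<close> is scalar on the orthogonal complement of the all-ones vector and the
  degree vector, and then \<open>\<Gamma>\<close> or its complement is disconnected; or \<open>\<theta>\<^sub>2\<close> is the nonmain
  eigenvalue, which is excluded by evaluating the quadratic forms of \<open>A\<close> and \<open>B\<close> at the degree vector
  minus its mean.

  If \<open>\<theta>\<^sub>1\<close> is not main, the vector \<open>d - \<theta>\<^sub>2\<close> (\<open>d\<close> the degree vector) spans the Perron eigenspace, and the
  diagonal of the rank-one matrix \<open>(A - \<theta>\<^sub>1)(A - \<theta>\<^sub>2)\<close> yields a quadratic equation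
  \<open>(d - \<theta>\<^sub>2)\<^sup>2 = k (d + \<theta>\<^sub>1\<theta>\<^sub>2)\<close> for every valency. Comparing it with the analogous equation of the
  complement gives \<open>k = n + \<theta>\<^sub>1 - \<theta>\<^sub>2\<close>.
\<close>

section \<open>Spectral theory of symmetric kernels on a finite set\<close>

text \<open>Vectors indexed by \<open>V\<close> are total functions vanishing off \<open>V\<close>,
  so equality of vectors is equality of functions and the product topology on functions is
  available.\<close>

definition vecs :: "'a set \<Rightarrow> ('a \<Rightarrow> real) set" where
  "vecs V = {x. \<forall>v. v \<notin> V \<longrightarrow> x v = 0}"

definition ip :: "'a set \<Rightarrow> ('a \<Rightarrow> real) \<Rightarrow> ('a \<Rightarrow> real) \<Rightarrow> real" where
  "ip V x y = (\<Sum>v\<in>V. x v * y v)"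

lemma ip_commute: "ip V x y = ip V y x"
  by (simp add: ip_def mult.commute)

lemma ip_add_left: "ip V (\<lambda>v. x v + y v) z = ip V x z + ip V y z"
  and ip_diff_left: "ip V (\<lambda>v. x v - y v) z = ip V x z - ip V y z"
  and ip_scale_left: "ip V (\<lambda>v. c * x v) z = c * ip V x z"
  and ip_add_right: "ip V z (\<lambda>v. x v + y v) = ip V z x + ip V z y"
  and ip_diff_right: "ip V z (\<lambda>v. x v - y v) = ip V z x - ip V z y"
  and ip_scale_right: "ip V z (\<lambda>v. c * x v) = c * ip V z x"
  by (simp_all add: ip_def algebra_simps sum.distrib sum_subtractf sum_distrib_left)

lemma ip_zero [simp]: "ip V (\<lambda>v. 0) z = 0" "ip V z (\<lambda>v. 0) = 0"
  by (simp_all add: ip_def)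

lemmas ip_linear = ip_add_left ip_diff_left ip_scale_left ip_add_right ip_diff_right ip_scale_right

lemma ip_self_nonneg: "ip V x x \<ge> 0"
  by (simp add: ip_def sum_nonneg)

lemma ip_self_eq_0:
  assumes "finite V" "x \<in> vecs V" "ip V x x = 0"
  shows "x = (\<lambda>v. 0)"
proof
  fix v
  have "\<forall>v\<in>V. x v * x v = 0"
    using assms by (subst (asm) ip_def) (simp add: sum_nonneg_eq_0_iff)
  then show "x v = 0" using assms(2) by (cases "v \<in> V") (auto simp: vecs_def)
qed

text \<open>This extracts the vanishing first variation of a quadratic form at an extremal
  vector.\<close>

lemma linear_coeff_eq_0:
  fixes p q :: real
  assumes "\<And>r. 0 \<le> 2 * r * p + r\<^sup>2 * q"
  shows "p = 0"
proof (rule ccontr)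
  assume p: "p \<noteq> 0"
  define k where "k = \<bar>q\<bar> + 1"
  have k: "k > 0" "q < k" by (auto simp: k_def)
  \<comment> \<open>For a small \<open>r\<close> of sign opposite to \<open>p\<close> the linear
    term wins; \<open>k > q\<close> makes \<open>r = - p / k\<close> small enough.\<close>
  have "0 \<le> (2 * (- p / k) * p + (- p / k)\<^sup>2 * q) * k\<^sup>2"
    using assms[of "- p / k"] by (intro mult_nonneg_nonneg) auto
  also have "\<dots> = p\<^sup>2 * (q - 2 * k)"
    using k by (simp add: field_simps power2_eq_square)
  also have "\<dots> < 0" using p k by (intro mult_pos_neg) auto
  finally show False by simp
qed

text \<open>Fewer homogeneous linear equations than unknowns have a nonzero solution. The induction
  is Gaussian elimination: the last equation is solved for a coordinate \<open>v\<close> that occurs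
  in it.\<close>

lemma exists_orthogonal_vector:
  fixes f :: "nat \<Rightarrow> 'a \<Rightarrow> real"
  assumes "finite V" "k < card V"
  shows "\<exists>x\<in>vecs V. x \<noteq> (\<lambda>v. 0) \<and> (\<forall>i<k. ip V (f i) x = 0)"
  using assms
proof (induction k arbitrary: V f)
  case 0
  then obtain v where v: "v \<in> V" by fastforce
  show ?case
    by (rule bexI[of _ "\<lambda>w. if w = v then 1 else 0"]) (use v in \<open>auto simp: vecs_def fun_eq_iff\<close>)
next
  case (Suc k)
  show ?case
  proof (cases "\<exists>v\<in>V. f k v \<noteq> 0")
    case False
    then have "ip V (f k) x = 0" for x by (auto simp: ip_def)
    moreover obtain x where "x \<in> vecs V" "x \<noteq> (\<lambda>v. 0)" "\<forall>i<k. ip V (f i) x = 0"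
      using Suc.IH[OF Suc.prems(1) Suc_lessD[OF Suc.prems(2)], of f] by blast
    ultimately show ?thesis by (auto simp: less_Suc_eq)
  next
    case True
    then obtain v where v: "v \<in> V" "f k v \<noteq> 0" by blast
    define W where "W = V - {v}"
    have W: "finite W" "k < card W" "V = insert v W" "v \<notin> W"
      using Suc v by (auto simp: W_def)
    \<comment> \<open>\<open>g i\<close> is the equation \<open>f i\<close> after eliminating the
      coordinate \<open>v\<close> by means of \<open>f k\<close>; the value of \<open>y\<close> at
      \<open>v\<close> below is the one that \<open>f k\<close> dictates.\<close>
    define g where "g i = (\<lambda>w. f i w - f i v / f k v * f k w)" for i
    obtain x where x: "x \<in> vecs W" "x \<noteq> (\<lambda>v. 0)" "\<forall>i<k. ip W (g i) x = 0"
      using Suc.IH[OF W(1,2)] by blast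
    define y where "y w = (if w = v then - ip W (f k) x / f k v else x w)" for w
    have ip_y: "ip V (f i) y = ip W (g i) x" for i
    proof -
      have "ip V (f i) y = f i v * y v + ip W (f i) y"
        using W by (simp add: ip_def)
      also have "ip W (f i) y = ip W (f i) x"
        using W unfolding ip_def y_def by (intro sum.cong) auto
      also have "f i v * y v + \<dots> = ip W (f i) x - f i v / f k v * ip W (f k) x"
        by (simp add: y_def)
      also have "\<dots> = ip W (g i) x"
        by (simp only: g_def ip_diff_left ip_scale_left)
      finally show ?thesis .
    qed
    have "g k = (\<lambda>w. 0)" using v by (simp add: g_def fun_eq_iff)
    then have "\<forall>i<Suc k. ip V (f i) y = 0"
      using x ip_y by (simp add: less_Suc_eq)
    moreover have "y \<in> vecs V" using x(1) W by (auto simp: vecs_def y_def)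
    moreover have "y \<noteq> (\<lambda>v. 0)"
    proof
      assume y0: "y = (\<lambda>v. 0)"
      have "x w = 0" for w
        using fun_cong[OF y0, of w] x(1) W by (cases "w = v") (auto simp: y_def vecs_def)
      with x(2) show False by auto
    qed
    ultimately show ?thesis by blast
  qed
qed

locale symmetric_kernel =
  fixes V :: "'a set" and a :: "'a \<Rightarrow> 'a \<Rightarrow> real"
  assumes fin: "finite V" and sym: "a u v = a v u" and supp: "u \<notin> V \<Longrightarrow> a u v = 0"
begin

definition op :: "('a \<Rightarrow> real) \<Rightarrow> 'a \<Rightarrow> real" where
  "op x u = (\<Sum>v\<in>V. a u v * x v)"

definition shift :: "real \<Rightarrow> ('a \<Rightarrow> real) \<Rightarrow> 'a \<Rightarrow> real" where
  "shift t x = (\<lambda>u. op x u - t * x u)"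

definition eigvec :: "real \<Rightarrow> ('a \<Rightarrow> real) \<Rightarrow> bool" where
  "eigvec t x \<longleftrightarrow> x \<in> vecs V \<and> (\<forall>u. op x u = t * x u)"

lemma op_vecs [simp]: "op x \<in> vecs V"
  by (simp add: vecs_def op_def supp)

lemma shift_vecs [simp]: "x \<in> vecs V \<Longrightarrow> shift t x \<in> vecs V"
  using op_vecs[of x] by (simp add: vecs_def shift_def)

lemma op_linear:
  "op (\<lambda>v. x v + y v) = (\<lambda>u. op x u + op y u)"
  "op (\<lambda>v. x v - y v) = (\<lambda>u. op x u - op y u)"
  "op (\<lambda>v. c * x v) = (\<lambda>u. c * op x u)"
  "op (\<lambda>v. 0) = (\<lambda>u. 0)"
  by (auto simp: op_def algebra_simps sum.distrib sum_subtractf sum_distrib_left)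

lemma shift_commute: "shift s (shift t x) = shift t (shift s x)"
  by (simp add: shift_def op_linear fun_eq_iff algebra_simps)

lemma shift_zero [simp]: "shift t (\<lambda>v. 0) = (\<lambda>v. 0)"
  by (simp add: shift_def op_linear)

lemma op_selfadjoint: "ip V (op x) y = ip V x (op y)"
proof -
  have "ip V (op x) y = (\<Sum>u\<in>V. \<Sum>v\<in>V. a u v * x v * y u)"
    by (simp add: ip_def op_def sum_distrib_right)
  also have "\<dots> = (\<Sum>v\<in>V. \<Sum>u\<in>V. a u v * x v * y u)"
    by (rule sum.swap)
  also have "\<dots> = ip V x (op y)"
    by (simp add: ip_def op_def sum_distrib_left sym mult_ac)
  finally show ?thesis .
qed

lemma shift_selfadjoint: "ip V (shift t x) y = ip V x (shift t y)"
  by (simp add: shift_def ip_linear op_selfadjoint)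

lemma eigvec_shift_iff: "eigvec t x \<longleftrightarrow> x \<in> vecs V \<and> shift t x = (\<lambda>v. 0)"
  by (auto simp: eigvec_def shift_def fun_eq_iff)

lemma eigvec_op: "eigvec t x \<Longrightarrow> op x = (\<lambda>u. t * x u)"
  by (auto simp: eigvec_def)

lemma shift_eigvec: "eigvec t x \<Longrightarrow> shift s x = (\<lambda>u. (t - s) * x u)"
  by (simp add: shift_def eigvec_op algebra_simps)

lemma shift_scale: "shift s (\<lambda>u. c * x u) = (\<lambda>u. c * shift s x u)"
  by (simp add: shift_def op_linear algebra_simps)

lemma eigvec_linear:
  assumes "eigvec t x" "eigvec t y"
  shows "eigvec t (\<lambda>v. c * x v - d * y v)"
  using assms by (auto simp: eigvec_def vecs_def op_linear algebra_simps)

section \<open>Spectral theorem by maximising the quadratic form\<close>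

definition orth :: "('a \<Rightarrow> real) set \<Rightarrow> ('a \<Rightarrow> real) set" where
  "orth Y = {x \<in> vecs V. \<forall>y\<in>Y. ip V x y = 0}"

lemma orth_add_scale: "x \<in> orth Y \<Longrightarrow> y \<in> orth Y \<Longrightarrow> (\<lambda>v. x v + r * y v) \<in> orth Y"
  by (auto simp: orth_def vecs_def ip_linear)

lemma orth_scale: "x \<in> orth Y \<Longrightarrow> (\<lambda>v. r * x v) \<in> orth Y"
  by (auto simp: orth_def vecs_def ip_linear)

text \<open>Perturb \<open>x\<close> in the direction \<open>y = shift t x\<close>, which stays in
  \<open>orth Y\<close> by invariance. The nonnegative form
  \<open>t * ip V z z - ip V (op z) z\<close> vanishes at \<open>x\<close>, and its first-order term
  is \<open>- 2 * r * ip V y y\<close>, so \<open>y\<close> must vanish.\<close>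

lemma eigvec_if_extremal:
  assumes bound: "\<And>y. y \<in> orth Y \<Longrightarrow> ip V (op y) y \<le> t * ip V y y"
    and inv: "\<And>y. y \<in> orth Y \<Longrightarrow> op y \<in> orth Y"
    and x: "x \<in> orth Y" "ip V (op x) x = t * ip V x x"
  shows "eigvec t x"
proof -
  define y where "y = shift t x"
  have y: "y \<in> orth Y"
    using orth_add_scale[OF inv[OF x(1)] x(1), of "- t"] by (simp add: y_def shift_def)
  have "0 \<le> 2 * r * (- ip V y y) + r\<^sup>2 * (t * ip V y y - ip V (op y) y)" for r
  proof -
    let ?z = "\<lambda>v. x v + r * y v"
    have e: "ip V y y = ip V (op x) y - t * ip V x y"
      by (subst (1) y_def) (simp add: shift_def ip_linear)
    have "0 \<le> t * ip V ?z ?z - ip V (op ?z) ?z"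
      using bound[OF orth_add_scale[OF x(1) y]] by simp
    also have "\<dots> = 2 * r * (- ip V y y) + r\<^sup>2 * (t * ip V y y - ip V (op y) y)"
      using x(2) op_selfadjoint[of y x] ip_commute[of V y x] ip_commute[of V y "op x"]
      by (subst e) (simp add: ip_linear op_linear algebra_simps power2_eq_square)
    finally show ?thesis .
  qed
  then have "ip V y y = 0" using linear_coeff_eq_0 by fastforce
  then have "y = (\<lambda>v. 0)" using ip_self_eq_0[OF fin] y by (auto simp: orth_def)
  then show ?thesis using x by (simp add: y_def eigvec_shift_iff orth_def)
qed

text \<open>In the topology of pointwise convergence the sphere is a closed subset of a product of
  compact factors: \<open>[-1, 1]\<close> at points of \<open>V\<close> and \<open>{0}\<close>
  elsewhere. The factors \<open>{0}\<close> allow the type of vertices to be infinite.\<close>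

lemma compact_unit_sphere: "compact {x \<in> orth Y. ip V x x = 1}"
proof -
  let ?K = "{x \<in> orth Y. ip V x x = 1}"
  let ?S = "\<lambda>v. if v \<in> V then {-1..1} else {0::real}"
  have "compactin (product_topology (\<lambda>_. euclidean) UNIV) (PiE UNIV ?S)"
    by (auto simp: compactin_PiE)
  then have box: "compact (PiE UNIV ?S)"
    by (simp add: euclidean_product_topology)
  have cont: "continuous_on UNIV (\<lambda>x. ip V x y)" "continuous_on UNIV (\<lambda>x. ip V x x)" for y
    unfolding ip_def by (intro continuous_intros continuous_on_product_coordinates)+
  have "?K = (\<Inter>v\<in>-V. {x. x v = 0}) \<inter> (\<Inter>y\<in>Y. {x. ip V x y = 0}) \<inter> {x. ip V x x = 1}"
    by (auto simp: orth_def vecs_def)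
  also have "closed \<dots>"
    by (intro closed_Int closed_INT ballI closed_Collect_eq cont continuous_intros
        continuous_on_product_coordinates)
  finally have "closed ?K" .
  moreover have "?K \<subseteq> PiE UNIV ?S"
  proof
    fix x assume x: "x \<in> ?K"
    have "x v \<in> ?S v" for v
    proof (cases "v \<in> V")
      case True
      have "x v * x v \<le> ip V x x" unfolding ip_def using True fin
        by (intro member_le_sum) auto
      then have "(x v)\<^sup>2 \<le> 1" using x by (simp add: power2_eq_square)
      then show ?thesis using True by (auto simp: abs_square_le_1 abs_le_iff)
    qed (use x in \<open>auto simp: orth_def vecs_def\<close>)
    then show "x \<in> PiE UNIV ?S" by auto
  qed
  ultimately show ?thesis using closed_Int_compact[OF _ box, of ?K] by (simp add: Int_absorb2)
qed

text \<open>By compactness the form attains its maximum \<open>t\<close> on the unit sphere of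
  \<open>orth Y\<close>. Homogeneity extends the bound to all of \<open>orth Y\<close>, and a
  maximiser is an eigenvector.\<close>

lemma obtain_max_eigvec:
  assumes inv: "\<And>y. y \<in> orth Y \<Longrightarrow> op y \<in> orth Y"
    and z: "z \<in> orth Y" "z \<noteq> (\<lambda>v. 0)"
  obtains x t where "x \<in> orth Y" "x \<noteq> (\<lambda>v. 0)" "eigvec t x"
    "\<And>y. y \<in> orth Y \<Longrightarrow> ip V (op y) y \<le> t * ip V y y"
proof -
  let ?K = "{x \<in> orth Y. ip V x x = 1}"
  have pos: "ip V y y > 0" if "y \<in> orth Y" "y \<noteq> (\<lambda>v. 0)" for y
    using that ip_self_eq_0[OF fin, of y] ip_self_nonneg[of V y] by (force simp: orth_def)
  have unit: "(\<lambda>v. (1 / sqrt (ip V y y)) * y v) \<in> ?K" if "y \<in> orth Y" "y \<noteq> (\<lambda>v. 0)" for y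
  proof -
    have "1 / sqrt (ip V y y) * (1 / sqrt (ip V y y) * ip V y y) = ip V y y / (sqrt (ip V y y) * sqrt (ip V y y))"
      by simp
    also have "\<dots> = 1" using pos[OF that] by (simp only: real_sqrt_mult_self) simp
    finally show ?thesis
      using orth_scale[OF that(1), of "1 / sqrt (ip V y y)"] by (simp add: ip_scale_left ip_scale_right del: times_divide_eq_left times_divide_eq_right)
  qed
  have "continuous_on ?K (\<lambda>x. ip V (op x) x)"
    unfolding ip_def op_def
    by (intro continuous_intros continuous_on_subset[OF continuous_on_product_coordinates]) auto
  then obtain x where x: "x \<in> ?K" "\<And>y. y \<in> ?K \<Longrightarrow> ip V (op y) y \<le> ip V (op x) x"
    using continuous_attains_sup[OF compact_unit_sphere, of Y "\<lambda>x. ip V (op x) x"] unit[OF z] by blast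
  define t where "t = ip V (op x) x"
  have bound: "ip V (op y) y \<le> t * ip V y y" if y: "y \<in> orth Y" for y
  proof (cases "y = (\<lambda>v. 0)")
    case False
    define c where "c = 1 / sqrt (ip V y y)"
    have c: "c * c * ip V y y = 1" using pos[OF y False] by (simp add: c_def)
    have "c * c * ip V (op y) y \<le> t"
      using x(2)[OF unit[OF y False, folded c_def]] by (simp add: ip_linear op_linear t_def mult_ac)
    then have "c * c * ip V (op y) y * ip V y y \<le> t * ip V y y"
      using pos[OF y False] by (intro mult_right_mono) auto
    moreover have "c * c * ip V (op y) y * ip V y y = ip V (op y) y * (c * c * ip V y y)" by simp
    ultimately show ?thesis using c by simp
  qed (simp add: op_linear)
  moreover have "eigvec t x"
    using eigvec_if_extremal[OF bound inv, of x] x(1) by (simp add: t_def)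
  ultimately show thesis using x(1) by (intro that[of x t]) auto
qed

text \<open>Completeness of the eigenvectors: their common orthogonal complement is invariant, so if
  nonzero it would contain an eigenvector, which is then orthogonal to itself.\<close>

lemma eq_0_if_orth_eigvecs:
  assumes x: "x \<in> vecs V" and orth: "\<And>t y. eigvec t y \<Longrightarrow> ip V x y = 0"
  shows "x = (\<lambda>v. 0)"
proof (rule ccontr)
  assume nz: "x \<noteq> (\<lambda>v. 0)"
  let ?Y = "{y. \<exists>t. eigvec t y}"
  have inv: "op y \<in> orth ?Y" if "y \<in> orth ?Y" for y
    using that by (auto simp: orth_def op_selfadjoint ip_scale_right eigvec_op)
  have "x \<in> orth ?Y" using x orth by (auto simp: orth_def)
  then obtain y t where "y \<in> orth ?Y" "y \<noteq> (\<lambda>v. 0)" "eigvec t y"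
    using obtain_max_eigvec[OF inv _ nz] by metis
  then show False using ip_self_eq_0[OF fin, of y] by (auto simp: orth_def)
qed

end

section \<open>Connected nonregular graphs with three eigenvalues\<close>

text \<open>Connectedness is phrased as a condition on cuts because it is only applied to cuts:
  around a single vertex, around the zero set of an eigenvector, and around a class of vertices of
  equal degree.\<close>

locale three_eigenvalue_kernel = symmetric_kernel +
  fixes t0 t1 t2 :: real
  assumes entries: "a u v = 0 \<or> a u v = 1" and no_loops: "a u u = 0"
    and joined: "U \<subseteq> V \<Longrightarrow> U \<noteq> {} \<Longrightarrow> U \<noteq> V \<Longrightarrow> \<exists>u\<in>U. \<exists>v\<in>V - U. a u v \<noteq> 0"
    and nonempty: "V \<noteq> {}"
    and order: "t0 > t1" "t1 > t2"
    and spectrum: "(\<exists>x. eigvec t x \<and> x \<noteq> (\<lambda>v. 0)) \<longleftrightarrow> t \<in> {t0, t1, t2}"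
    and irregular: "\<exists>u\<in>V. \<exists>v\<in>V. (\<Sum>w\<in>V. a u w) \<noteq> (\<Sum>w\<in>V. a v w)"
begin

abbreviation deg :: "'a \<Rightarrow> real" where
  "deg u \<equiv> \<Sum>w\<in>V. a u w"

abbreviation unit :: "'a \<Rightarrow> real" where
  "unit \<equiv> indicator V"

lemma unit_vecs [simp]: "unit \<in> vecs V"
  by (simp add: vecs_def)

lemma op_unit: "op unit = deg"
  by (simp add: op_def fun_eq_iff indicator_def)

lemma ip_unit: "ip V x unit = sum x V" "ip V unit x = sum x V"
  by (simp_all add: ip_def indicator_def)

lemma eigvec_cases:
  assumes "eigvec t x"
  shows "x = (\<lambda>v. 0) \<or> t = t0 \<or> t = t1 \<or> t = t2"
  using spectrum[of t] assms by auto

text \<open>The polynomial with roots \<open>t0\<close>, \<open>t1\<close>, \<open>t2\<close>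
  annihilates \<open>A\<close>: by self-adjointness the factors can be moved onto an eigenvector,
  one of whose factors is zero.\<close>

lemma cubic:
  assumes "x \<in> vecs V"
  shows "shift t0 (shift t1 (shift t2 x)) = (\<lambda>v. 0)"
proof (rule eq_0_if_orth_eigvecs)
  fix t y assume y: "eigvec t y"
  have "shift t2 (shift t1 (shift t0 y)) = (\<lambda>u. (t - t0) * ((t - t1) * ((t - t2) * y u)))"
    by (simp add: shift_eigvec[OF y] shift_scale)
  also have "\<dots> = (\<lambda>v. 0)" using eigvec_cases[OF y] by auto
  finally show "ip V (shift t0 (shift t1 (shift t2 x))) y = 0"
    by (simp add: shift_selfadjoint)
qed (use assms in simp)

lemma eigvec_shift_shift:
  assumes "x \<in> vecs V"
  shows "eigvec t0 (shift t1 (shift t2 x))" "eigvec t1 (shift t0 (shift t2 x))"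
    "eigvec t2 (shift t0 (shift t1 x))"
  using cubic[OF assms] assms by (simp_all add: eigvec_shift_iff shift_commute)

section \<open>The Perron eigenspace\<close>

lemma rayleigh:
  assumes "x \<in> vecs V"
  shows "ip V (op x) x \<le> t0 * ip V x x"
proof -
  have all: "orth {} = vecs V" by (simp add: orth_def)
  have "unit \<noteq> (\<lambda>v. 0)" using nonempty by (auto simp: fun_eq_iff indicator_def)
  then obtain z t where z: "z \<noteq> (\<lambda>v. 0)" "eigvec t z"
    "\<And>y. y \<in> vecs V \<Longrightarrow> ip V (op y) y \<le> t * ip V y y"
    using obtain_max_eigvec[of "{}" unit] unfolding all by (metis op_vecs unit_vecs)
  have "t \<le> t0" using z spectrum[of t] order by auto
  then have "t * ip V x x \<le> t0 * ip V x x"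
    by (intro mult_right_mono ip_self_nonneg)
  then show ?thesis using z(3)[OF assms] by linarith
qed

text \<open>Since the entries are nonnegative, absolute values keep the norm and do not decrease the
  form; hence the absolute value of a maximiser is again a maximiser.\<close>

lemma eigvec_abs:
  assumes x: "eigvec t0 x"
  shows "eigvec t0 (\<lambda>v. \<bar>x v\<bar>)"
proof -
  let ?y = "\<lambda>v. \<bar>x v\<bar>"
  have all: "orth {} = vecs V" by (simp add: orth_def)
  have y: "?y \<in> vecs V" using x by (auto simp: eigvec_def vecs_def)
  have "t0 * ip V ?y ?y = t0 * ip V x x" by (simp add: ip_def)
  also have "\<dots> = ip V (op x) x" by (simp add: eigvec_op[OF x] ip_scale_left)
  also have "\<dots> \<le> ip V (op ?y) ?y"
    unfolding ip_def op_def sum_distrib_right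
  proof (intro sum_mono)
    fix u v
    have "a u v * x v * x u \<le> \<bar>a u v * x v * x u\<bar>" by simp
    also have "\<dots> = a u v * \<bar>x v\<bar> * \<bar>x u\<bar>" using entries[of u v] by (auto simp: abs_mult)
    finally show "a u v * x v * x u \<le> a u v * \<bar>x v\<bar> * \<bar>x u\<bar>" .
  qed
  finally have "ip V (op ?y) ?y = t0 * ip V ?y ?y" using rayleigh[OF y] by linarith
  then show ?thesis
    using eigvec_if_extremal[of "{}" t0 ?y] rayleigh y unfolding all by simp
qed

text \<open>Otherwise connectedness joins a zero \<open>u\<close> of \<open>x\<close> to a vertex
  where \<open>x\<close> is positive, and the eigenvalue equation at \<open>u\<close> equates a
  positive sum with zero.\<close>

lemma nonneg_eigvec_pos:
  assumes x: "eigvec t x" and nonneg: "\<And>v. x v \<ge> 0" and nz: "x \<noteq> (\<lambda>v. 0)" and v: "v \<in> V"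
  shows "x v > 0"
proof (rule ccontr)
  assume "\<not> x v > 0"
  then have v0: "x v = 0" using nonneg[of v] by linarith
  let ?U = "{u \<in> V. x u = 0}"
  have "?U \<noteq> V" using nz x by (auto simp: eigvec_def vecs_def fun_eq_iff)
  then obtain u w where u: "u \<in> V" "x u = 0" and w: "w \<in> V" "x w \<noteq> 0" and uw: "a u w \<noteq> 0"
    using joined[of ?U] v v0 by blast
  have "(\<Sum>v\<in>V. a u v * x v) = 0"
    using x u(2) by (simp add: eigvec_def op_def)
  moreover have "a u v * x v \<ge> 0" for v
    using entries[of u v] nonneg[of v] by auto
  ultimately have "a u w * x w = 0"
    using w(1) fin by (simp add: sum_nonneg_eq_0_iff)
  with uw w show False by simp
qed

text \<open>Summation is injective on the \<open>t0\<close>-eigenspace. This makes \<open>t0\<close>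
  main, and it also makes the eigenspace one-dimensional, since a combination of two eigenvectors
  with zero sum vanishes.\<close>

lemma perron:
  assumes x: "eigvec t0 x" and sum: "sum x V = 0"
  shows "x = (\<lambda>v. 0)"
proof -
  \<comment> \<open>This is the nonnegative eigenvector \<open>\<bar>x v\<bar> + x v\<close>,
    written in the shape of \<open>eigvec_linear\<close>. If it is zero then \<open>x\<close> is
    nonpositive; if not, it is positive on \<open>V\<close> and so is \<open>x\<close>.\<close>
  let ?y = "\<lambda>v. 1 * \<bar>x v\<bar> - (-1) * x v"
  have y: "eigvec t0 ?y" by (intro eigvec_linear eigvec_abs x)
  have "x v = 0" if "v \<in> V" for v
  proof (cases "?y = (\<lambda>v. 0)")
    case True
    then have neg: "x v \<le> 0" for v using fun_cong[OF True, of v] by auto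
    have "(\<Sum>v\<in>V. - x v) = 0" using sum by (simp add: sum_negf)
    then show ?thesis using neg that fin by (subst (asm) sum_nonneg_eq_0_iff) auto
  next
    case False
    have "x v > 0" if "v \<in> V" for v
    proof -
      have "1 * \<bar>x v\<bar> - (-1) * x v > 0" by (rule nonneg_eigvec_pos[OF y _ False that]) simp
      then show ?thesis by linarith
    qed
    then have "sum x V > 0" using fin nonempty by (intro sum_pos) auto
    then show ?thesis using sum by simp
  qed
  then show ?thesis using x by (auto simp: eigvec_def vecs_def)
qed

section \<open>Main eigenvalues\<close>

definition main :: "real \<Rightarrow> bool" where
  "main t \<longleftrightarrow> (\<exists>x. eigvec t x \<and> sum x V \<noteq> 0)"

lemma main_t0: "main t0"
  using spectrum[of t0] perron unfolding main_def by blast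

lemma sum_shift_shift_unit:
  "sum (shift s (shift t x)) V = ip V x (shift s (shift t unit))"
  by (simp add: ip_unit(1)[symmetric] shift_selfadjoint shift_commute)

text \<open>The all-ones vector has no component in the eigenspace of a nonmain \<open>t\<close>, so
  the two remaining factors already annihilate it.\<close>

lemma nonmain_shift:
  assumes "\<not> main t" "{s, t} = {t1, t2}"
  shows "shift t0 (shift s unit) = (\<lambda>v. 0)"
proof -
  let ?z = "shift t0 (shift s unit)"
  have z: "eigvec t ?z"
    using eigvec_shift_shift[of unit] assms(2) by (auto simp: doubleton_eq_iff)
  have "ip V ?z ?z = ip V (shift s (shift t0 ?z)) unit"
    by (simp add: shift_selfadjoint)
  also have "\<dots> = (t - t0) * ((t - s) * sum ?z V)"
    by (simp add: shift_eigvec[OF z] shift_scale ip_scale_left ip_unit)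
  also have "\<dots> = 0" using z assms(1) by (auto simp: main_def)
  finally show ?thesis using ip_self_eq_0[OF fin, of ?z] by simp
qed

lemma shift_shift_unit:
  "shift s (shift t unit) u = op deg u - (s + t) * deg u + s * t * unit u"
  by (simp add: shift_def op_linear op_unit algebra_simps)

lemma op_deg:
  assumes "\<not> main t" "{s, t} = {t1, t2}" "u \<in> V"
  shows "op deg u = (t0 + s) * deg u - t0 * s"
  using fun_cong[OF nonmain_shift[OF assms(1,2)], of u] shift_shift_unit[of t0 s u] assms(3)
  by simp

text \<open>As \<open>deg\<close> is \<open>A\<close> applied to the all-ones vector, pairing the
  relation with a main eigenvector \<open>x\<close> turns \<open>op deg\<close>, \<open>deg\<close>
  and \<open>unit\<close> into \<open>t\<^sup>2\<close>, \<open>t\<close> and \<open>1\<close> times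
  the nonzero \<open>sum x V\<close>.\<close>

lemma main_root:
  assumes "main t" and "\<And>u. u \<in> V \<Longrightarrow> op deg u = p * deg u + q"
  shows "t\<^sup>2 = p * t + q"
proof -
  obtain x where x: "eigvec t x" "sum x V \<noteq> 0" using assms(1) by (auto simp: main_def)
  have d: "ip V x deg = t * sum x V"
    by (simp add: op_unit[symmetric] op_selfadjoint[symmetric] eigvec_op[OF x(1)] ip_scale_left ip_unit)
  have "t\<^sup>2 * sum x V = t * ip V x deg" by (simp add: d power2_eq_square)
  also have "\<dots> = ip V x (op deg)"
    by (simp add: op_selfadjoint[symmetric] eigvec_op[OF x(1)] ip_scale_left)
  also have "\<dots> = (\<Sum>v\<in>V. x v * (p * deg v + q))"
    unfolding ip_def by (intro sum.cong) (simp_all add: assms(2))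
  also have "\<dots> = p * ip V x deg + q * sum x V"
    by (simp add: ip_def algebra_simps sum.distrib sum_distrib_left)
  also have "\<dots> = (p * t + q) * sum x V" by (simp add: d algebra_simps)
  finally show ?thesis using x(2) by simp
qed

lemma exists_nonmain:
  assumes "\<And>u. u \<in> V \<Longrightarrow> op deg u = p * deg u + q"
  shows "\<not> main t1 \<or> \<not> main t2"
proof (rule ccontr)
  assume "\<not> ?thesis"
  then have "t1\<^sup>2 = p * t1 + q" "t2\<^sup>2 = p * t2 + q" "t0\<^sup>2 = p * t0 + q"
    using main_root[OF _ assms] main_t0 by blast+
  then have "(t0 - t1) * (t0 + t1 - p) = 0" "(t0 - t2) * (t0 + t2 - p) = 0"
    by (simp_all add: algebra_simps power2_eq_square)
  then show False using order by auto
qed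

lemma neighbour: assumes "u \<in> V" shows "\<exists>v\<in>V. a u v = 1"
proof -
  have "{u} \<noteq> V" using irregular by auto
  then show ?thesis using joined[of "{u}"] assms entries[of u] by auto
qed

lemma shift_cancel:
  assumes "shift s x = (\<lambda>v. 0)" "shift t x = (\<lambda>v. 0)" "s \<noteq> t"
  shows "x = (\<lambda>v. 0)"
proof
  fix u
  have "(t - s) * x u = shift s x u - shift t x u" by (simp add: shift_def algebra_simps)
  then show "x u = 0" using assms by simp
qed

text \<open>\<open>deg\<close> and \<open>op deg\<close> are \<open>A\<close> and its square applied
  to the all-ones vector, so \<open>x\<close> is orthogonal to every quadratic polynomial in
  \<open>A\<close> applied to that vector.\<close>

lemma sum_shift_shift_eq_0:
  assumes "x \<in> vecs V" "sum x V = 0" "ip V deg x = 0" "ip V (op deg) x = 0"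
  shows "sum (shift s (shift t x)) V = 0"
proof -
  have "sum (shift s (shift t x)) V
      = ip V (\<lambda>u. op deg u - (s + t) * deg u + (s * t) * unit u) x"
    by (simp add: sum_shift_shift_unit shift_shift_unit[abs_def] ip_commute[of V x])
  also have "\<dots> = 0" using assms by (simp add: ip_add_left ip_diff_left ip_scale_left ip_unit)
  finally show ?thesis .
qed

text \<open>On \<open>V\<close> the vector \<open>w\<close> is a combination of \<open>unit\<close>
  and \<open>deg\<close>, hence it lies in the sum of the eigenspaces for \<open>t0\<close> and
  \<open>t1\<close>, where the form is at least \<open>t1\<close> times the squared norm.\<close>

lemma form_ge_if_nonmain:
  assumes t2: "\<not> main t2" and w: "w \<in> vecs V" "\<And>u. u \<in> V \<Longrightarrow> w u = \<alpha> * deg u + \<beta>"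
  shows "ip V (op w) w \<ge> t1 * ip V w w"
proof -
  have "shift t0 (shift t1 w) = (\<lambda>v. 0)"
  proof -
    have lin: "shift s (\<lambda>u. c * x u + d * y u) = (\<lambda>u. c * shift s x u + d * shift s y u)" for s c d x y
      by (simp add: shift_def op_linear algebra_simps)
    have z: "shift t0 (shift t1 unit) = (\<lambda>v. 0)" using nonmain_shift[OF t2, of t1] by simp
    have "w = (\<lambda>u. \<alpha> * shift t1 unit u + (\<beta> + \<alpha> * t1) * unit u)"
    proof
      fix u
      show "w u = \<alpha> * shift t1 unit u + (\<beta> + \<alpha> * t1) * unit u"
        using w by (cases "u \<in> V") (simp_all add: shift_def op_unit vecs_def supp algebra_simps)
    qed
    then have "shift t0 (shift t1 w)
        = (\<lambda>u. \<alpha> * shift t0 (shift t1 (shift t1 unit)) u + (\<beta> + \<alpha> * t1) * shift t0 (shift t1 unit) u)"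
      by (simp only: lin)
    also have "shift t0 (shift t1 (shift t1 unit)) = shift t1 (shift t0 (shift t1 unit))"
      by (rule shift_commute)
    finally show ?thesis by (simp add: z)
  qed
  then have y: "eigvec t0 (shift t1 w)" using w by (simp add: eigvec_shift_iff)
  have "0 \<le> ip V (shift t1 w) (shift t1 w)" by (rule ip_self_nonneg)
  also have "\<dots> = (t0 - t1) * ip V w (shift t1 w)"
    by (subst shift_selfadjoint) (simp add: shift_eigvec[OF y] ip_scale_right)
  finally have "ip V w (shift t1 w) \<ge> 0" using order by (simp add: zero_le_mult_iff)
  then show ?thesis unfolding shift_selfadjoint[symmetric]
    by (simp add: shift_def ip_diff_left ip_scale_left)
qed

text \<open>Every column of \<open>M = (A - t1) (A - t2)\<close> lies in the Perron eigenspace,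
  spanned by \<open>f\<close>, which is \<open>deg - t2\<close> on \<open>V\<close>. The column at
  \<open>v\<close> has sum \<open>(t0 - t1) * f v\<close> and diagonal entry
  \<open>deg v + t1 * t2\<close>; proportionality to \<open>f\<close> gives the quadratic. Summing
  it over \<open>V\<close> gives the last equation.\<close>

lemma quadratic_if_nonmain:
  assumes "\<not> main t1"
  obtains k where "k > 0" "\<And>u. u \<in> V \<Longrightarrow> (deg u - t2)\<^sup>2 = k * (deg u + t1 * t2)"
    "(t0 - t1) * (t0 - t2) = (t0 - t1) * k + real (card V) * (t2 * (t1 + 1))"
proof -
  define f where "f = shift t2 unit"
  have f_eq: "f u = deg u - t2" if "u \<in> V" for u
    using that by (simp add: f_def shift_def op_unit)
  have f: "eigvec t0 f"
    using nonmain_shift[OF assms, of t2] by (simp add: f_def eigvec_shift_iff insert_commute)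
  have f_nz: "f \<noteq> (\<lambda>v. 0)"
  proof
    assume "f = (\<lambda>v. 0)"
    then have "deg u = t2" if "u \<in> V" for u using f_eq[OF that] by simp
    then show False using irregular by metis
  qed
  have ff: "ip V f f = (t0 - t2) * sum f V"
  proof -
    have "ip V f f = ip V unit (shift t2 f)"
      by (subst (1) f_def) (simp add: shift_selfadjoint)
    then show ?thesis by (simp add: shift_eigvec[OF f] ip_scale_right ip_unit)
  qed
  moreover have "ip V f f > 0"
    using ip_self_eq_0[OF fin, of f] f f_nz ip_self_nonneg[of V f] by (force simp: eigvec_def)
  ultimately have S: "sum f V > 0"
    using order by (simp add: zero_less_mult_iff)
  have one_dim: "sum f V * x u = sum x V * f u" if "eigvec t0 x" for x u
  proof -
    have "sum (\<lambda>u. sum f V * x u - sum x V * f u) V = 0"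
      by (simp add: sum_subtractf sum_distrib_left[symmetric])
    from fun_cong[OF perron[OF eigvec_linear[OF that f] this], of u] show ?thesis by simp
  qed
  define k where "k = sum f V / (t0 - t1)"
  have k: "k > 0" using S order by (simp add: k_def)
  have quad: "(f v)\<^sup>2 = k * (deg v + t1 * t2)" if v: "v \<in> V" for v
  proof -
    let ?e = "indicator {v} :: 'a \<Rightarrow> real"
    let ?m = "shift t1 (shift t2 ?e)"
    have e: "?e \<in> vecs V" using v by (auto simp: vecs_def indicator_def)
    have op_e: "op ?e u = a u v" for u
      using v fin by (simp add: op_def indicator_def if_distrib cong: if_cong)
    have aa: "a v w * a w v = a v w" for w using entries[of v w] sym[of v w] by auto
    \<comment> \<open>The diagonal of the square of \<open>A\<close> consists of the degrees,
      because the entries are 0 or 1.\<close>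
    have "op (op ?e) v = (\<Sum>w\<in>V. a v w * a w v)" by (simp add: op_def[of "op ?e"] op_e)
    then have op_op: "op (op ?e) v = deg v" by (simp only: aa)
    have "?m v = op (op ?e) v - (t1 + t2) * op ?e v + t1 * t2 * ?e v"
      by (simp add: shift_def op_linear algebra_simps)
    then have "?m v = deg v + t1 * t2" unfolding op_op by (simp add: op_e no_loops)
    moreover have "sum ?m V = (t0 - t1) * f v"
    proof -
      have "sum ?m V = ip V ?e (shift t1 f)"
        by (simp only: sum_shift_shift_unit f_def)
      also have "\<dots> = (t0 - t1) * f v"
        using v fin by (simp add: shift_eigvec[OF f] ip_def indicator_def)
      finally show ?thesis .
    qed
    ultimately have "sum f V * (deg v + t1 * t2) = (t0 - t1) * (f v)\<^sup>2"
      using one_dim[OF eigvec_shift_shift(1)[OF e], of v] by (simp add: power2_eq_square)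
    then show ?thesis using order by (simp add: k_def field_simps)
  qed
  have "(t0 - t2) * sum f V = (\<Sum>v\<in>V. (f v)\<^sup>2)"
    by (simp add: ff[symmetric] ip_def power2_eq_square)
  also have "\<dots> = (\<Sum>v\<in>V. k * (f v + t2 * (t1 + 1)))"
  proof (intro sum.cong refl)
    show "(f v)\<^sup>2 = k * (f v + t2 * (t1 + 1))" if "v \<in> V" for v
      unfolding quad[OF that] unfolding f_eq[OF that] by (simp add: algebra_simps)
  qed
  also have "\<dots> = k * (sum f V + real (card V) * (t2 * (t1 + 1)))"
    by (simp add: sum_distrib_left[symmetric] sum.distrib)
  also have "sum f V = (t0 - t1) * k" using order by (simp add: k_def)
  finally have "k * ((t0 - t1) * (t0 - t2)) = k * ((t0 - t1) * k + real (card V) * (t2 * (t1 + 1)))"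
    by (simp add: mult_ac)
  then show thesis using k quad f_eq by (intro that[of k]) auto
qed

end

section \<open>A graph together with its complement\<close>

locale complementary_kernels =
  G: three_eigenvalue_kernel V a t0 t1 t2 + H: three_eigenvalue_kernel V b s0 s1 s2
  for V :: "'a set" and a t0 t1 t2 b s0 s1 s2 +
  assumes compl: "u \<in> V \<Longrightarrow> v \<in> V \<Longrightarrow> a u v + b u v = (if u = v then 0 else 1)"
begin

text \<open>Interpreting this inside later proofs makes every earlier result available with the
  roles of the two graphs exchanged.\<close>

lemma swap: "complementary_kernels V b s0 s1 s2 a t0 t1 t2"
  by unfold_locales (use compl in \<open>simp add: add.commute\<close>)

lemma op_compl:
  assumes "u \<in> V"
  shows "H.op x u = sum x V - x u - G.op x u"
proof -
  have "H.op x u + G.op x u = (\<Sum>v\<in>V. (a u v + b u v) * x v)"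
    by (simp add: G.op_def H.op_def sum.distrib[symmetric] algebra_simps)
  also have "\<dots> = (\<Sum>v\<in>V. x v - (if v = u then x v else 0))"
    by (intro sum.cong) (use assms compl in auto)
  also have "\<dots> = sum x V - x u"
    using assms G.fin by (simp add: sum_subtractf)
  finally show ?thesis by simp
qed

lemma deg_compl:
  assumes "u \<in> V"
  shows "H.deg u = real (card V) - 1 - G.deg u"
proof -
  have "H.op H.unit u = sum H.unit V - H.unit u - G.op G.unit u" by (rule op_compl[OF assms])
  then show ?thesis using assms by (simp add: H.op_unit G.op_unit indicator_def)
qed

text \<open>The span of \<open>unit\<close> and \<open>deg\<close> on \<open>V\<close> is the same
  for both graphs. Only the coefficient of the degrees matters later, so the constant term stays
  existential.\<close>

lemma op_deg_compl:
  assumes G: "\<And>u. u \<in> V \<Longrightarrow> G.op G.deg u = p * G.deg u + q"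
  shows "\<exists>q'. \<forall>u\<in>V. H.op H.deg u = (real (card V) - 2 - p) * H.deg u + q'"
proof -
  let ?n = "real (card V)"
  have "H.op H.deg u = (?n - 2 - p) * H.deg u + (sum H.deg V + q - (?n - 1 - p) * (?n - 1))"
    if u: "u \<in> V" for u
  proof -
    have "G.op H.deg u = (\<Sum>v\<in>V. a u v * (?n - 1 - G.deg v))"
      unfolding G.op_def by (intro sum.cong) (simp_all add: deg_compl)
    also have "\<dots> = (?n - 1) * G.deg u - G.op G.deg u"
      by (simp add: G.op_def algebra_simps sum_subtractf sum_distrib_left sum.distrib)
    finally have "H.op H.deg u
        = sum H.deg V - H.deg u - ((?n - 1) * G.deg u - (p * G.deg u + q))"
      by (simp add: op_compl[OF u] G[OF u])
    moreover have "G.deg u = ?n - 1 - H.deg u" using deg_compl[OF u] by simp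
    ultimately show ?thesis by (simp only:) (simp add: algebra_simps)
  qed
  then show ?thesis by blast
qed

text \<open>Evaluate \<open>ip V x (H.op y)\<close> in two ways. With \<open>B = J - I - A\<close>
  all terms in \<open>ip V x y\<close> cancel, and only the contribution
  \<open>sum x V * sum y V\<close> of \<open>J\<close> remains.\<close>

lemma not_both_main: "\<not> (G.main t \<and> H.main (- 1 - t))"
proof
  assume "G.main t \<and> H.main (- 1 - t)"
  then obtain x y where x: "G.eigvec t x" "sum x V \<noteq> 0" and y: "H.eigvec (- 1 - t) y" "sum y V \<noteq> 0"
    by (auto simp: G.main_def H.main_def)
  have "(- 1 - t) * ip V x y = ip V x (H.op y)"
    by (simp add: H.eigvec_op[OF y(1)] ip_scale_right)
  also have "\<dots> = (\<Sum>v\<in>V. x v * (sum y V - y v - G.op y v))"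
    unfolding ip_def by (intro sum.cong) (simp_all add: op_compl)
  also have "\<dots> = sum x V * sum y V - ip V x y - ip V (G.op x) y"
    unfolding G.op_selfadjoint
    by (simp add: ip_def right_diff_distrib sum_subtractf sum_distrib_right[symmetric])
  also have "\<dots> = sum x V * sum y V - ip V x y - t * ip V x y"
    by (simp add: G.eigvec_op[OF x(1)] ip_scale_left)
  finally have "sum x V * sum y V = 0" by (simp add: algebra_simps)
  then show False using x y by simp
qed

text \<open>\<open>J\<close> kills \<open>x\<close>, so \<open>x\<close> is an eigenvector of
  \<open>B\<close> too; its zero sum rules out the Perron eigenvalue \<open>s0\<close>.\<close>

lemma perp_eigvec:
  assumes x: "G.eigvec t x" "sum x V = 0" "x \<noteq> (\<lambda>v. 0)"
  shows "- 1 - t = s1 \<or> - 1 - t = s2"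
proof -
  have "H.op x u = (- 1 - t) * x u" for u
  proof (cases "u \<in> V")
    case False
    then show ?thesis using x(1) H.op_vecs[of x] by (simp add: vecs_def G.eigvec_def)
  qed (use x in \<open>simp add: op_compl G.eigvec_def algebra_simps\<close>)
  then have "H.eigvec (- 1 - t) x" using x(1) by (simp add: G.eigvec_def H.eigvec_def)
  then show ?thesis using H.eigvec_cases[of "- 1 - t" x] H.perron[of x] x by auto
qed

lemma nonmain_compl:
  assumes "\<not> G.main t" "t = t1 \<or> t = t2"
  shows "- 1 - t = s1 \<or> - 1 - t = s2"
proof -
  obtain x where "G.eigvec t x" "x \<noteq> (\<lambda>v. 0)" using G.spectrum[of t] assms(2) by auto
  then show ?thesis using perp_eigvec[of t x] assms(1) by (auto simp: G.main_def)
qed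

text \<open>A nonmain eigenvalue makes \<open>op deg\<close> affine in \<open>deg\<close>. This
  property passes to the complement, where a quadratic cannot have three main eigenvalues as
  roots.\<close>

lemma nonmain_transfer:
  assumes "\<not> G.main t1 \<or> \<not> G.main t2"
  shows "\<not> H.main s1 \<or> \<not> H.main s2"
proof -
  obtain t s where "\<not> G.main t" "{s, t} = {t1, t2}" using assms by blast
  then have G: "G.op G.deg u = (t0 + s) * G.deg u + - (t0 * s)" if "u \<in> V" for u
    using G.op_deg[OF _ _ that] by simp
  obtain q where "\<forall>u\<in>V. H.op H.deg u = (real (card V) - 2 - (t0 + s)) * H.deg u + q"
    using op_deg_compl[OF G] by blast
  then show ?thesis by (intro H.exists_nonmain) blast
qed

section \<open>Coinciding valencies\<close>

definition valency :: "'a \<Rightarrow> nat" where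
  "valency u = card {v \<in> V. a u v = 1}"

lemma deg_eq_valency: "G.deg u = real (valency u)"
proof -
  have "G.deg u = (\<Sum>v\<in>V. if a u v = 1 then 1 else 0)"
    by (intro sum.cong) (use G.entries[of u] in auto)
  then show ?thesis using G.fin by (simp add: valency_def sum.If_cases Int_def)
qed

lemma valency_bounds:
  assumes u: "u \<in> V"
  shows "1 \<le> valency u" "valency u \<le> card V - 2"
proof -
  obtain v where "v \<in> V" "a u v = 1" using G.neighbour[OF u] by blast
  then have "{v \<in> V. a u v = 1} \<noteq> {}" by blast
  then show "1 \<le> valency u" using G.fin by (simp add: valency_def card_gt_0_iff Suc_le_eq)
  obtain w where w: "w \<in> V" "b u w = 1" using H.neighbour[OF u] by blast
  then have "w \<noteq> u" using H.no_loops[of u] by auto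
  then have "a u w = 0" using w compl[OF u w(1)] by simp
  then have "{v \<in> V. a u v = 1} \<subseteq> V - {u, w}" using w G.no_loops[of u] by auto
  then have "valency u \<le> card (V - {u, w})"
    unfolding valency_def using G.fin by (intro card_mono) auto
  also have "\<dots> = card V - 2"
    using \<open>w \<noteq> u\<close> u w G.fin by (simp add: card_Diff_subset)
  finally show "valency u \<le> card V - 2" .
qed

lemma card_ge_4: "card V \<ge> 4"
proof (rule ccontr)
  assume n: "\<not> card V \<ge> 4"
  have "valency u = 1" if "u \<in> V" for u
    using valency_bounds[OF that] n by linarith
  then show False using G.irregular by (auto simp: deg_eq_valency)
qed

text \<open>Pigeonhole: neither graph has an isolated vertex, so only the valencies from 1 to
  \<open>card V - 2\<close> are possible.\<close>

lemma obtain_equal_deg: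
  obtains u v where "u \<in> V" "v \<in> V" "u \<noteq> v" "G.deg u = G.deg v"
proof -
  have "valency ` V \<subseteq> {1..card V - 2}" using valency_bounds by auto
  then have "card (valency ` V) \<le> card V - 2"
    using card_mono[of "{1..card V - 2}"] by auto
  then have "\<not> inj_on valency V"
    using card_ge_4 pigeonhole[of valency V] by linarith
  then obtain u v where "u \<in> V" "v \<in> V" "u \<noteq> v" "valency u = valency v"
    unfolding inj_on_def by blast
  then show thesis by (intro that[of u v]) (auto simp: deg_eq_valency)
qed

text \<open>The rows of \<open>a - t\<close> attached to vertices of equal degree coincide and no third degree is
  possible, so all vertices of one degree are joined to all those of the other degree or to none.\<close>

lemma not_eigvec_on_orth_unit_deg:
  assumes eig: "\<And>x. x \<in> vecs V \<Longrightarrow> sum x V = 0 \<Longrightarrow> ip V G.deg x = 0 \<Longrightarrow> G.eigvec t x"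
  shows False
proof -
  define c where "c u v = a u v - t * indicator {v} u" for u v
  have comb: "\<alpha> * c z u + \<beta> * c z v + \<gamma> * c z w = 0"
    if uvw: "u \<in> V" "v \<in> V" "w \<in> V" and z: "z \<in> V" and coeff: "\<alpha> + \<beta> + \<gamma> = 0"
      "\<alpha> * G.deg u + \<beta> * G.deg v + \<gamma> * G.deg w = 0"
    for u v w z \<alpha> \<beta> \<gamma>
  proof -
    let ?x = "\<lambda>y. \<alpha> * indicator {u} y + \<beta> * indicator {v} y + \<gamma> * indicator {w} y"
    have point: "ip V y (indicator {r}) = y r" if "r \<in> V" for y r
      using that G.fin by (simp add: ip_def indicator_def if_distrib cong: if_cong)
    have ip_x: "ip V y ?x = \<alpha> * y u + \<beta> * y v + \<gamma> * y w" for y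
      using uvw by (simp add: ip_add_right ip_scale_right point)
    have "?x \<in> vecs V" using uvw by (auto simp: vecs_def indicator_def)
    moreover have "sum ?x V = 0"
      using ip_x[of G.unit] uvw coeff by (simp only: G.ip_unit) simp
    moreover have "ip V G.deg ?x = 0" using ip_x[of G.deg] coeff by simp
    ultimately have "G.op ?x z = t * ?x z" using eig[of ?x] by (simp add: G.eigvec_def)
    moreover have "G.op ?x z = \<alpha> * a z u + \<beta> * a z v + \<gamma> * a z w"
      using ip_x[of "a z"] by (simp add: G.op_def ip_def)
    ultimately show ?thesis
      by (simp add: c_def algebra_simps)
  qed
  \<comment> \<open>Two vertices of equal degree suffice: the third vertex gets coefficient
    0.\<close>
  have twin: "c z u = c z v" if "u \<in> V" "v \<in> V" "z \<in> V" "G.deg u = G.deg v" for u v z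
    using comb[OF that(1,2,2,3), of 1 "-1" 0] that(4) by simp
  have sym_c: "c u v = c v u" for u v by (auto simp: c_def G.sym indicator_def)
  obtain u\<^sub>0 v\<^sub>0 where "u\<^sub>0 \<in> V" "v\<^sub>0 \<in> V" "u\<^sub>0 \<noteq> v\<^sub>0" "G.deg u\<^sub>0 = G.deg v\<^sub>0" by (rule obtain_equal_deg)
  \<comment> \<open>Compare the entries of two equal columns in row \<open>u\<^sub>0\<close>: one is
    diagonal, the other is not. So \<open>t\<close> is 0 or -1, and either way \<open>A - t\<close>
    has entries 0 and 1.\<close>
  then have "- t = a u\<^sub>0 v\<^sub>0" using twin[of u\<^sub>0 v\<^sub>0 u\<^sub>0] G.no_loops by (simp add: c_def indicator_def)
  then have t: "t = 0 \<or> t = - 1" using G.entries[of u\<^sub>0 v\<^sub>0] by auto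
  have entries: "c u v = 0 \<or> c u v = 1" for u v
    using t G.entries[of u v] G.no_loops by (auto simp: c_def indicator_def)
  have sum_c: "(\<Sum>z\<in>V. c z u) = G.deg u - t" if "u \<in> V" for u
    using that G.fin by (simp add: c_def sum_subtractf G.sym[of _ u] sum_distrib_left[symmetric] indicator_def)
  have two_degs: False
    if "u \<in> V" "v \<in> V" "w \<in> V" and ne: "G.deg u \<noteq> G.deg v" "G.deg v \<noteq> G.deg w" "G.deg u \<noteq> G.deg w"
    for u v w
  proof -
    have "c z u = c z v" if "z \<in> V" for z
    proof -
      \<comment> \<open>The three coefficients sum to zero and none of them is zero, so entries in
        {0, 1} must all agree. Equal columns then have equal sums, contradicting distinct
        degrees.\<close>
      have "(G.deg v - G.deg w) * c z u + (G.deg w - G.deg u) * c z v + (G.deg u - G.deg v) * c z w = 0"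
        by (rule comb[OF \<open>u \<in> V\<close> \<open>v \<in> V\<close> \<open>w \<in> V\<close> that]) (simp_all add: algebra_simps)
      then show ?thesis
        using entries[of z u] entries[of z v] entries[of z w] ne by auto
    qed
    then have "(\<Sum>z\<in>V. c z u) = (\<Sum>z\<in>V. c z v)" by simp
    then show False using sum_c that by simp
  qed
  obtain u\<^sub>1 v\<^sub>1 where uv: "u\<^sub>1 \<in> V" "v\<^sub>1 \<in> V" "G.deg u\<^sub>1 \<noteq> G.deg v\<^sub>1" using G.irregular by blast
  let ?P = "{u \<in> V. G.deg u = G.deg u\<^sub>1}"
  have cross: "a u v = a u\<^sub>1 v\<^sub>1" if "u \<in> ?P" "v \<in> V - ?P" for u v
  proof -
    have v: "G.deg v = G.deg v\<^sub>1" 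
    proof (rule ccontr)
      assume "G.deg v \<noteq> G.deg v\<^sub>1"
      then show False using two_degs[of u\<^sub>1 v v\<^sub>1] uv that by auto
    qed
    have "c u v = c u v\<^sub>1" using twin[of v v\<^sub>1 u] that v uv by auto
    also have "\<dots> = c v\<^sub>1 u\<^sub>1" using twin[of u u\<^sub>1 v\<^sub>1] that uv by (simp add: sym_c[of u])
    finally have "c u v = c u\<^sub>1 v\<^sub>1" by (simp only: sym_c)
    moreover have "u \<noteq> v" "u\<^sub>1 \<noteq> v\<^sub>1" using that uv by auto
    ultimately show ?thesis by (simp add: c_def)
  qed
  have "v\<^sub>1 \<notin> ?P" using uv by simp
  then have P: "?P \<subseteq> V" "?P \<noteq> {}" "?P \<noteq> V" using uv by blast+
  \<comment> \<open>Connectedness of the graph gives an edge across the cut, connectedness of the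
    complement a non-edge, but \<open>cross\<close> makes all such pairs alike.\<close>
  obtain u v where "u \<in> ?P" "v \<in> V - ?P" "a u v \<noteq> 0" using G.joined[OF P] by blast
  moreover obtain u' v' where "u' \<in> ?P" "v' \<in> V - ?P" "b u' v' \<noteq> 0" using H.joined[OF P] by blast
  moreover have "u' \<noteq> v'" using calculation by auto
  ultimately show False
    using cross[of u v] cross[of u' v'] G.entries[of u v] compl[of u' v'] by simp
qed

text \<open>If all eigenvalues of one graph are main, so are those of the other, and then no
  eigenvector of \<open>A\<close> has zero sum. With at least four vertices some nonzero
  \<open>x\<close> is orthogonal to \<open>unit\<close>, \<open>deg\<close> and
  \<open>op deg\<close>; its components in the three eigenspaces have zero sum and hence
  vanish.\<close>

lemma some_nonmain: "\<not> G.main t1 \<or> \<not> G.main t2"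
proof (rule ccontr)
  assume "\<not> ?thesis"
  then have mainG: "G.main t1" "G.main t2" by auto
  interpret swap: complementary_kernels V b s0 s1 s2 a t0 t1 t2 by (rule swap)
  have mainH: "H.main s1" "H.main s2" using swap.nonmain_transfer mainG by auto
  have triv: "x = (\<lambda>v. 0)" if "G.eigvec t x" "t \<in> {t0, t1, t2}" "sum x V = 0" for x t
  proof (rule ccontr)
    assume x: "x \<noteq> (\<lambda>v. 0)"
    have "G.main t" using that mainG G.main_t0 by auto
    then have "\<not> H.main (- 1 - t)" using not_both_main by blast
    then show False using perp_eigvec[OF that(1,3) x] mainH by auto
  qed
  define f where "f i = (if i = 0 then G.unit else if i = 1 then G.deg else G.op G.deg)" for i :: nat
  obtain x where x: "x \<in> vecs V" "x \<noteq> (\<lambda>v. 0)" "\<forall>i<3. ip V (f i) x = 0"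
    using exists_orthogonal_vector[OF G.fin, of 3 f] card_ge_4 by auto
  have "sum x V = 0" "ip V G.deg x = 0" "ip V (G.op G.deg) x = 0"
    using x(3)[rule_format, of 0] x(3)[rule_format, of 1] x(3)[rule_format, of 2]
    by (simp_all add: f_def G.ip_unit)
  then have zero: "G.shift s (G.shift t x) = (\<lambda>v. 0)" if "G.eigvec r (G.shift s (G.shift t x))" "r \<in> {t0, t1, t2}" for r s t
    using triv[OF that] G.sum_shift_shift_eq_0[OF x(1)] by auto
  note zeros = G.eigvec_shift_shift(1)[OF x(1), THEN zero, simplified]
    G.eigvec_shift_shift(2)[OF x(1), THEN zero, simplified]
    G.eigvec_shift_shift(3)[OF x(1), THEN zero, simplified]
  have "G.shift t2 x = (\<lambda>v. 0)" using G.shift_cancel[OF zeros(1,2)] G.order by auto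
  moreover have "G.shift t1 x = (\<lambda>v. 0)"
    using G.shift_cancel[of t0 "G.shift t1 x" t2] zeros G.order by (auto simp: G.shift_commute)
  ultimately show False using G.shift_cancel[of t1 x t2] G.order x(2) by auto
qed

text \<open>Otherwise take \<open>x\<close> orthogonal to \<open>unit\<close> and
  \<open>deg\<close>. As \<open>op deg\<close> is affine in \<open>deg\<close>, the components of
  \<open>x\<close> for \<open>t0\<close> and \<open>s\<close> have zero sum and vanish. So
  \<open>A\<close> would be the scalar \<open>t\<close> on all such \<open>x\<close>, which is
  impossible.\<close>

lemma perp_eigvec_of_main:
  assumes "\<not> G.main t" "{s, t} = {t1, t2}"
  shows "\<exists>x. G.eigvec s x \<and> sum x V = 0 \<and> x \<noteq> (\<lambda>v. 0)"
proof (rule ccontr)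
  assume neg: "\<not> ?thesis"
  have order: "t0 \<noteq> s" "t0 \<noteq> t" using assms G.order by (auto simp: doubleton_eq_iff)
  have "G.eigvec t x" if x: "x \<in> vecs V" "sum x V = 0" "ip V G.deg x = 0" for x
  proof -
    have "ip V (G.op G.deg) x = (\<Sum>v\<in>V. ((t0 + s) * G.deg v - t0 * s) * x v)"
      unfolding ip_def by (intro sum.cong) (simp_all add: G.op_deg[OF assms])
    also have "\<dots> = (t0 + s) * ip V G.deg x - t0 * s * sum x V"
      by (simp add: ip_def algebra_simps sum_subtractf sum.distrib sum_distrib_left)
    finally have d: "ip V (G.op G.deg) x = 0" using x by simp
    note sum0 = G.sum_shift_shift_eq_0[OF x d]
    have "G.eigvec s (G.shift t0 (G.shift t x))" "G.eigvec t0 (G.shift s (G.shift t x))"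
      using assms(2) G.eigvec_shift_shift[OF x(1)] by (auto simp: doubleton_eq_iff G.shift_commute)
    then have "G.shift t0 (G.shift t x) = (\<lambda>v. 0)" "G.shift s (G.shift t x) = (\<lambda>v. 0)"
      using neg sum0 G.perron by blast+
    then show ?thesis using G.shift_cancel[OF _ _ order(1)] x by (simp add: G.eigvec_shift_iff)
  qed
  then show False by (rule not_eigvec_on_orth_unit_deg)
qed

lemma eigvals_compl: "- 1 - t1 \<in> {s1, s2}" "- 1 - t2 \<in> {s1, s2}"
proof -
  have "- 1 - s \<in> {s1, s2} \<and> - 1 - t \<in> {s1, s2}" if t: "\<not> G.main t" "{s, t} = {t1, t2}" for s t
    using perp_eigvec_of_main[OF t] perp_eigvec nonmain_compl[OF t(1)] t(2) by auto
  then show "- 1 - t1 \<in> {s1, s2}" "- 1 - t2 \<in> {s1, s2}"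
    using some_nonmain by (metis insert_commute)+
qed

lemma eigvals_eq: "s1 = - 1 - t2" "s2 = - 1 - t1"
  using eigvals_compl G.order H.order by auto

text \<open>Otherwise \<open>t2\<close> and \<open>s2\<close> are nonmain. For \<open>w\<close>, the
  degree vector minus its mean, the two forms add up to \<open>- ip V w w\<close>, yet they are at
  least \<open>t1\<close> and \<open>s1 = - 1 - t2\<close> times \<open>ip V w w\<close>. As
  \<open>t1 > t2\<close> this forces \<open>w\<close> to vanish, contradicting irregularity.\<close>

lemma nonmain_t1: "\<not> G.main t1"
proof
  assume main: "G.main t1"
  then have G: "\<not> G.main t2" using some_nonmain by blast
  have H: "\<not> H.main s2" using not_both_main[of t1] main by (simp add: eigvals_eq)
  define m where "m = sum G.deg V / real (card V)"
  define w where "w u = G.deg u - m * G.unit u" for u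
  have w: "w \<in> vecs V" by (simp add: w_def vecs_def G.supp)
  have "sum w V = 0"
    using card_ge_4 by (simp add: w_def sum_subtractf m_def)
  then have "ip V (H.op w) w = (\<Sum>u\<in>V. (- w u - G.op w u) * w u)"
    unfolding ip_def by (intro sum.cong) (simp_all add: op_compl)
  also have "\<dots> = - ip V w w - ip V (G.op w) w"
    by (simp add: ip_def algebra_simps sum_subtractf sum_negf)
  finally have sum_forms: "ip V (H.op w) w + ip V (G.op w) w = - ip V w w" by simp
  have "ip V (G.op w) w \<ge> t1 * ip V w w"
    by (rule G.form_ge_if_nonmain[OF G w, of 1 "- m"]) (simp add: w_def)
  moreover have "ip V (H.op w) w \<ge> s1 * ip V w w"
    by (rule H.form_ge_if_nonmain[OF H w, of "- 1" "real (card V) - 1 - m"]) (simp add: w_def deg_compl)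
  ultimately have "(t1 - t2) * ip V w w \<le> 0"
    using sum_forms by (simp add: eigvals_eq algebra_simps)
  then have "ip V w w = 0"
    using G.order ip_self_nonneg[of V w] by (simp add: mult_le_0_iff)
  then have "w = (\<lambda>v. 0)" using ip_self_eq_0 G.fin w by blast
  then have "w u = 0" for u by simp
  then have "G.deg u = m" if "u \<in> V" for u using that unfolding w_def by (simp add: indicator_def)
  then show False using G.irregular by metis
qed

text \<open>Two affine expressions for \<open>H.op H.deg\<close> in terms of \<open>H.deg\<close>
  are available; since \<open>H.deg\<close> is not constant, their coefficients
  \<open>s0 + s2\<close> and \<open>card V - 2 - (t0 + t2)\<close> agree.\<close>

lemma eigval_s0: "s0 = real (card V) - 1 - t0 + t1 - t2"
proof -
  interpret swap: complementary_kernels V b s0 s1 s2 a t0 t1 t2 by (rule swap)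
  have G: "G.op G.deg u = (t0 + t2) * G.deg u + - (t0 * t2)" if "u \<in> V" for u
    using G.op_deg[OF nonmain_t1 _ that, of t2] by (simp add: insert_commute)
  have H: "H.op H.deg u = (s0 + s2) * H.deg u - s0 * s2" if "u \<in> V" for u
    using H.op_deg[OF swap.nonmain_t1 _ that, of s2] by (simp add: insert_commute)
  obtain q where q: "\<forall>u\<in>V. H.op H.deg u = (real (card V) - 2 - (t0 + t2)) * H.deg u + q"
    using op_deg_compl[OF G] by blast
  obtain u v where uv: "u \<in> V" "v \<in> V" "H.deg u \<noteq> H.deg v" using H.irregular by blast
  have "(s0 + s2 - (real (card V) - 2 - (t0 + t2))) * (H.deg u - H.deg v) = 0"
    using q[rule_format, OF uv(1)] q[rule_format, OF uv(2)] H[OF uv(1)] H[OF uv(2)] by (simp add: algebra_simps)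
  then show ?thesis using uv(3) by (simp add: eigvals_eq)
qed

lemma degree_quadratic:
  defines "N \<equiv> real (card V) + t1 - t2"
  shows "\<And>u. u \<in> V \<Longrightarrow> (G.deg u - t2)\<^sup>2 = N * (G.deg u + t1 * t2)"
    "(t0 - t1)\<^sup>2 = real (card V) * (t0 - t1 + t1 * t2 + t2)"
proof -
  interpret swap: complementary_kernels V b s0 s1 s2 a t0 t1 t2 by (rule swap)
  define q where "q = t2 * (t1 + 1)"
  obtain k where k: "k > 0" "\<And>u. u \<in> V \<Longrightarrow> (G.deg u - t2)\<^sup>2 = k * (G.deg u + t1 * t2)"
    "(t0 - t1) * (t0 - t2) = (t0 - t1) * k + real (card V) * (t2 * (t1 + 1))"
    using G.quadratic_if_nonmain[OF nonmain_t1] by blast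
  obtain l where l: "l > 0" "\<And>u. u \<in> V \<Longrightarrow> (H.deg u - s2)\<^sup>2 = l * (H.deg u + s1 * s2)"
    using H.quadratic_if_nonmain[OF swap.nonmain_t1] by blast
  obtain u v where uv: "u \<in> V" "v \<in> V" "G.deg u \<noteq> G.deg v" using G.irregular by blast
  define x y where "x = G.deg u - t2" and "y = G.deg v - t2"
  have xy: "x \<noteq> y" using uv by (simp add: x_def y_def)
  have x: "x\<^sup>2 = k * (x + q)" and y: "y\<^sup>2 = k * (y + q)"
    using k(2)[OF uv(1)] k(2)[OF uv(2)] by (simp_all add: x_def y_def q_def algebra_simps)
  \<comment> \<open>The quantity \<open>H.deg u - s2\<close> equals \<open>N - x\<close>, and
    \<open>s2 * (s1 + 1)\<close> equals the same \<open>q\<close>, so the complement's equation is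
    the original one with \<open>N - x\<close> for \<open>x\<close> and \<open>l\<close> for
    \<open>k\<close>.\<close>
  have x': "(N - x)\<^sup>2 = l * (N - x + q)" and y': "(N - y)\<^sup>2 = l * (N - y + q)"
    using l(2)[OF uv(1)] l(2)[OF uv(2)]
    by (simp_all add: x_def y_def q_def N_def deg_compl uv eigvals_eq algebra_simps)
  have "(x - y) * (x + y - k) = 0" using x y by (simp add: algebra_simps power2_eq_square)
  then have sum: "x + y = k" using xy by simp
  have "(x - y) * (2 * N - (x + y) - l) = 0" using x' y' by (simp add: algebra_simps power2_eq_square)
  then have kl: "l = 2 * N - k" using xy sum by simp
  \<comment> \<open>By Vieta \<open>x + y = k\<close> and \<open>(N - x) + (N - y) = l\<close>.
    Substituting \<open>l = 2 * N - k\<close> and eliminating the square of \<open>x\<close> leaves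
    this product.\<close>
  have "(k - N) * (N + 2 * q) = 0"
    using x x' unfolding kl by (simp add: algebra_simps power2_eq_square)
  moreover have "N + 2 * q \<noteq> 0"
  proof
    assume N: "N + 2 * q = 0"
    \<comment> \<open>The squared difference of the roots is the discriminant
      \<open>k\<^sup>2 + 4 * k * q\<close>, which in this case would equal
      \<open>- (k * l)\<close>.\<close>
    have "(x - y)\<^sup>2 = 2 * x\<^sup>2 + 2 * y\<^sup>2 - (x + y)\<^sup>2" by (simp add: algebra_simps power2_eq_square)
    also have "\<dots> = 2 * (k * (x + q)) + 2 * (k * (y + q)) - k\<^sup>2" by (simp only: x y sum)
    also have "\<dots> = 2 * k * (x + y + 2 * q) - k\<^sup>2" by (simp add: algebra_simps)
    also have "\<dots> = - (k * l)"
    proof -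
      have "2 * q = - N" using N by simp
      then show ?thesis unfolding kl sum by (simp add: algebra_simps power2_eq_square)
    qed
    also have "\<dots> < 0" using k(1) l(1) by simp
    finally show False by (simp add: not_less[symmetric])
  qed
  ultimately have kN: "k = N" by simp
  show "\<And>u. u \<in> V \<Longrightarrow> (G.deg u - t2)\<^sup>2 = N * (G.deg u + t1 * t2)"
    using k kN by simp_all
  show "(t0 - t1)\<^sup>2 = real (card V) * (t0 - t1 + t1 * t2 + t2)"
    using k(3) unfolding kN N_def by (simp add: algebra_simps power2_eq_square)
qed

end

section \<open>Passage to graphs\<close>

text \<open>A path that starts in \<open>U\<close> could never leave it. Connectedness is defined
  through the symmetric closure, which for a \<open>pair_graph\<close> has the same arcs.\<close>

lemma connected_joined:
  assumes G: "pair_graph G" "Digraph_Component.connected (with_proj G)"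
    and U: "U \<subseteq> pverts G" "U \<noteq> {}" "U \<noteq> pverts G"
  shows "\<exists>u\<in>U. \<exists>v\<in>pverts G - U. (u, v) \<in> parcs G"
proof (rule ccontr)
  assume neg: "\<not> ?thesis"
  interpret pair_graph G by (rule G)
  obtain u v where u: "u \<in> U" and v: "v \<in> pverts G" "v \<notin> U" using U by blast
  have "u \<rightarrow>\<^sup>*\<^bsub>mk_symmetric G\<^esub> v"
    using G(2) u v U unfolding connected_def strongly_connected_def by auto
  moreover have "parcs (mk_symmetric G) = parcs G"
    by (auto simp: parcs_mk_symmetric intro: arcs_symmetric)
  ultimately have "(u, v) \<in> rtrancl_on (pverts G) (parcs G)"
    by (simp add: reachable_def)
  then have "v \<in> U"
    using u neg by (induction rule: rtrancl_on.induct) auto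
  with v show False by simp
qed

definition adjacency :: "'a pair_pre_digraph \<Rightarrow> 'a \<Rightarrow> 'a \<Rightarrow> real" where
  "adjacency G u v = (if (u, v) \<in> parcs G then 1 else 0)"

lemma symmetric_kernel_adjacency:
  assumes "pair_graph G"
  shows "symmetric_kernel (pverts G) (adjacency G)"
proof -
  interpret pair_graph G by (rule assms)
  show ?thesis
    by unfold_locales (auto simp: adjacency_def pair_finite_verts intro: arcs_symmetric dest: in_arcsD1)
qed

lemma graph_eigenvalue_eigvec:
  assumes G: "pair_graph G"
  shows "graph_eigenvalue G t \<longleftrightarrow>
    (\<exists>x. symmetric_kernel.eigvec (pverts G) (adjacency G) t x \<and> x \<noteq> (\<lambda>v. 0))"
proof -
  interpret symmetric_kernel "pverts G" "adjacency G" by (rule symmetric_kernel_adjacency[OF G])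
  obtain vs where vs: "distinct vs" "set vs = pverts G"
    using finite_distinct_list[OF fin] by blast
  have op_eq: "op x u = (\<Sum>v\<in>pverts G. if (u, v) \<in> parcs G then x v else 0)" for x u
    unfolding op_def by (intro sum.cong) (auto simp: adjacency_def)
  have "graph_eigenvalue G t \<longleftrightarrow>
      (\<exists>x. (\<exists>v\<in>pverts G. x v \<noteq> 0) \<and> (\<forall>u\<in>pverts G. op x u = t * x u))"
    unfolding graph_eigenvalue_iff[OF vs] eigenvalue_adjacency_matrix_iff[OF vs(1)] vs(2) op_eq ..
  also have "\<dots> \<longleftrightarrow> (\<exists>x. eigvec t x \<and> x \<noteq> (\<lambda>v. 0))"
  proof
    assume "\<exists>x. (\<exists>v\<in>pverts G. x v \<noteq> 0) \<and> (\<forall>u\<in>pverts G. op x u = t * x u)"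
    then obtain x v where x: "v \<in> pverts G" "x v \<noteq> 0" "\<forall>u\<in>pverts G. op x u = t * x u" by blast
    \<comment> \<open>An eigenvector of the matrix only determines values on the vertex set; cutting
      off elsewhere puts it into \<open>vecs\<close>.\<close>
    define y where "y u = (if u \<in> pverts G then x u else 0)" for u
    have "op y = op x" by (auto simp: op_def y_def fun_eq_iff intro!: sum.cong)
    moreover have "op x u = 0" if "u \<notin> pverts G" for u
      using op_vecs[of x] that by (simp add: vecs_def)
    ultimately have "eigvec t y" using x by (auto simp: eigvec_def vecs_def y_def)
    moreover have "y \<noteq> (\<lambda>v. 0)" using x by (auto simp: y_def fun_eq_iff)
    ultimately show "\<exists>x. eigvec t x \<and> x \<noteq> (\<lambda>v. 0)" by blast
  next
    assume "\<exists>x. eigvec t x \<and> x \<noteq> (\<lambda>v. 0)"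
    then show "\<exists>x. (\<exists>v\<in>pverts G. x v \<noteq> 0) \<and> (\<forall>u\<in>pverts G. op x u = t * x u)"
      unfolding eigvec_def vecs_def fun_eq_iff by blast
  qed
  finally show ?thesis .
qed

lemma sum_adjacency:
  assumes "pair_graph G"
  shows "(\<Sum>v\<in>pverts G. adjacency G u v) = out_degree (with_proj G) u"
proof -
  interpret pair_graph G by (rule assms)
  have "out_arcs (with_proj G) u = Pair u ` {v \<in> pverts G. (u, v) \<in> parcs G}"
    by (auto simp: out_arcs_def dest: in_arcsD2)
  then have "out_degree (with_proj G) u = card {v \<in> pverts G. (u, v) \<in> parcs G}"
    by (simp add: out_degree_def card_image inj_on_def)
  then show ?thesis
    using pair_finite_verts by (simp add: adjacency_def sum.If_cases Int_def)
qed

lemma three_eigenvalue_kernel_adjacency: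
  assumes "t0 > t1" "t1 > t2" and "G \<in> three_eigenvalue_graphs t0 t1 t2"
  shows "three_eigenvalue_kernel (pverts G) (adjacency G) t0 t1 t2"
proof -
  have G: "pair_graph G" "Digraph_Component.connected (with_proj G)" "\<not> regular G"
    and eig: "{t. graph_eigenvalue G t} = {t0, t1, t2}"
    using assms(3) by (auto simp: three_eigenvalue_graphs_def)
  interpret pair_graph G by (rule G)
  interpret symmetric_kernel "pverts G" "adjacency G" by (rule symmetric_kernel_adjacency[OF G(1)])
  show ?thesis
  proof
    show "\<exists>u\<in>U. \<exists>v\<in>pverts G - U. adjacency G u v \<noteq> 0"
      if "U \<subseteq> pverts G" "U \<noteq> {}" "U \<noteq> pverts G" for U
      using connected_joined[OF G(1,2) that] by (simp add: adjacency_def)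
    show "(\<exists>x. eigvec t x \<and> x \<noteq> (\<lambda>v. 0)) \<longleftrightarrow> t \<in> {t0, t1, t2}" for t
      using eig graph_eigenvalue_eigvec[OF G(1), of t] by blast
    show "pverts G \<noteq> {}" using G(3) by (auto simp: regular_def)
    have "\<exists>u\<in>pverts G. \<exists>v\<in>pverts G. out_degree (with_proj G) u \<noteq> out_degree (with_proj G) v"
      using G(3) unfolding regular_def by metis
    then show "\<exists>u\<in>pverts G. \<exists>v\<in>pverts G.
        (\<Sum>w\<in>pverts G. adjacency G u w) \<noteq> (\<Sum>w\<in>pverts G. adjacency G v w)"
      by (simp add: sum_adjacency[OF G(1)])
    show "adjacency G u u = 0" for u using no_loops' by (auto simp: adjacency_def)
  qed (use assms in \<open>auto simp: adjacency_def\<close>)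
qed

theorem theorem6p2:
  fixes \<Gamma> :: "'a pair_pre_digraph" and n :: nat
    and \<theta>\<^sub>0 \<theta>\<^sub>1 \<theta>\<^sub>2 \<theta>\<^sub>0' \<theta>\<^sub>1' \<theta>\<^sub>2' :: real
  assumes "card (pverts \<Gamma>) = n"
    and "\<theta>\<^sub>0 > \<theta>\<^sub>1" and "\<theta>\<^sub>1 > \<theta>\<^sub>2"
    and "\<Gamma> \<in> three_eigenvalue_graphs \<theta>\<^sub>0 \<theta>\<^sub>1 \<theta>\<^sub>2"
    and "\<theta>\<^sub>0' > \<theta>\<^sub>1'" and "\<theta>\<^sub>1' > \<theta>\<^sub>2'"
    and "complement \<Gamma> \<in> three_eigenvalue_graphs \<theta>\<^sub>0' \<theta>\<^sub>1' \<theta>\<^sub>2'"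
  shows "biregular \<Gamma> \<and>
    (n + \<theta>\<^sub>1 + \<theta>\<^sub>2 + 2 * \<theta>\<^sub>1 * \<theta>\<^sub>2)\<^sup>2 - 4 * \<theta>\<^sub>2\<^sup>2 * (\<theta>\<^sub>1 + 1)\<^sup>2 \<ge> 0 \<and>
    real ` valencies \<Gamma> =
      {(n + \<theta>\<^sub>1 + \<theta>\<^sub>2 + sqrt ((n + \<theta>\<^sub>1 + \<theta>\<^sub>2 + 2 * \<theta>\<^sub>1 * \<theta>\<^sub>2)\<^sup>2 - 4 * \<theta>\<^sub>2\<^sup>2 * (\<theta>\<^sub>1 + 1)\<^sup>2)) / 2,
       (n + \<theta>\<^sub>1 + \<theta>\<^sub>2 - sqrt ((n + \<theta>\<^sub>1 + \<theta>\<^sub>2 + 2 * \<theta>\<^sub>1 * \<theta>\<^sub>2)\<^sup>2 - 4 * \<theta>\<^sub>2\<^sup>2 * (\<theta>\<^sub>1 + 1)\<^sup>2)) / 2} \<and>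
    \<theta>\<^sub>0 - \<theta>\<^sub>1 + \<theta>\<^sub>1 * \<theta>\<^sub>2 + \<theta>\<^sub>2 \<noteq> 0 \<and>
    n = (\<theta>\<^sub>0 - \<theta>\<^sub>1)\<^sup>2 / (\<theta>\<^sub>0 - \<theta>\<^sub>1 + \<theta>\<^sub>1 * \<theta>\<^sub>2 + \<theta>\<^sub>2) \<and>
    n * (n + 4 * \<theta>\<^sub>2 * (\<theta>\<^sub>1 + 1)) \<ge> 0 \<and>
    (\<theta>\<^sub>0 = n / 2 + \<theta>\<^sub>1 + sqrt (n * (n + 4 * \<theta>\<^sub>2 * (\<theta>\<^sub>1 + 1))) / 2 \<or>
     \<theta>\<^sub>0 = n / 2 + \<theta>\<^sub>1 - sqrt (n * (n + 4 * \<theta>\<^sub>2 * (\<theta>\<^sub>1 + 1))) / 2) \<and>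
    \<theta>\<^sub>0' = real n - 1 - \<theta>\<^sub>0 + \<theta>\<^sub>1 - \<theta>\<^sub>2 \<and>
    \<theta>\<^sub>1' = - 1 - \<theta>\<^sub>2 \<and>
    \<theta>\<^sub>2' = - 1 - \<theta>\<^sub>1"
proof -
  let ?V = "pverts \<Gamma>"
  have V: "pverts (complement \<Gamma>) = ?V" by (simp add: complement_def)
  interpret G: three_eigenvalue_kernel ?V "adjacency \<Gamma>" \<theta>\<^sub>0 \<theta>\<^sub>1 \<theta>\<^sub>2
    using three_eigenvalue_kernel_adjacency[OF assms(2,3,4)] .
  interpret H: three_eigenvalue_kernel ?V "adjacency (complement \<Gamma>)" \<theta>\<^sub>0' \<theta>\<^sub>1' \<theta>\<^sub>2'
    using three_eigenvalue_kernel_adjacency[OF assms(5,6,7)] unfolding V .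
  interpret complementary_kernels ?V "adjacency \<Gamma>" \<theta>\<^sub>0 \<theta>\<^sub>1 \<theta>\<^sub>2
    "adjacency (complement \<Gamma>)" \<theta>\<^sub>0' \<theta>\<^sub>1' \<theta>\<^sub>2'
  proof
    show "adjacency \<Gamma> u v + adjacency (complement \<Gamma>) u v = (if u = v then 0 else 1)"
      if "u \<in> ?V" "v \<in> ?V" for u v
      using that G.no_loops[of u] by (auto simp: adjacency_def complement_def split: if_splits)
  qed
  have graph: "pair_graph \<Gamma>" using assms(4) by (simp add: three_eigenvalue_graphs_def)
  define s where "s = n + \<theta>\<^sub>1 + \<theta>\<^sub>2"
  define D where "D = (n + \<theta>\<^sub>1 + \<theta>\<^sub>2 + 2 * \<theta>\<^sub>1 * \<theta>\<^sub>2)\<^sup>2 - 4 * \<theta>\<^sub>2\<^sup>2 * (\<theta>\<^sub>1 + 1)\<^sup>2"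
  have D: "(2 * G.deg u - s)\<^sup>2 = D" if "u \<in> ?V" for u
  proof -
    \<comment> \<open>Completing the square in the quadratic equation for the valencies.\<close>
    have "(2 * G.deg u - s)\<^sup>2 - D = 4 * ((G.deg u - \<theta>\<^sub>2)\<^sup>2 - (n + \<theta>\<^sub>1 - \<theta>\<^sub>2) * (G.deg u + \<theta>\<^sub>1 * \<theta>\<^sub>2))"
      by (simp add: s_def D_def algebra_simps power2_eq_square)
    also have "\<dots> = 0" using degree_quadratic(1)[OF that] assms(1) by simp
    finally show ?thesis by simp
  qed
  have deg: "G.deg u = (s + sqrt D) / 2 \<or> G.deg u = (s - sqrt D) / 2" if "u \<in> ?V" for u
    unfolding D[OF that, symmetric] by (auto simp: abs_if)
  obtain u v where uv: "u \<in> ?V" "v \<in> ?V" "G.deg u \<noteq> G.deg v" using G.irregular by blast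
  have D_nonneg: "D \<ge> 0" using D[OF uv(1)] zero_le_power2 by metis
  have valencies: "real ` valencies \<Gamma> = {(s + sqrt D) / 2, (s - sqrt D) / 2}"
  proof -
    have "real ` valencies \<Gamma> = G.deg ` ?V"
      by (simp add: valencies_def image_image sum_adjacency[OF graph])
    also have "\<dots> = {(s + sqrt D) / 2, (s - sqrt D) / 2}"
    proof
      show "G.deg ` ?V \<subseteq> {(s + sqrt D) / 2, (s - sqrt D) / 2}" using deg by blast
      \<comment> \<open>Two distinct degrees among two possible values exhaust both, so both signs
        occur.\<close>
      have "{G.deg u, G.deg v} = {(s + sqrt D) / 2, (s - sqrt D) / 2}"
        using deg[OF uv(1)] deg[OF uv(2)] uv(3) by (elim disjE) (simp_all only: insert_commute)
      then show "{(s + sqrt D) / 2, (s - sqrt D) / 2} \<subseteq> G.deg ` ?V" using uv(1,2) by auto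
    qed
    finally show ?thesis .
  qed
  have "(s + sqrt D) / 2 \<noteq> (s - sqrt D) / 2" using deg[OF uv(1)] deg[OF uv(2)] uv(3) by auto
  then have "card (real ` valencies \<Gamma>) = 2" unfolding valencies by simp
  then have "biregular \<Gamma>" by (simp add: biregular_def card_image)
  moreover have n: "(\<theta>\<^sub>0 - \<theta>\<^sub>1)\<^sup>2 = n * (\<theta>\<^sub>0 - \<theta>\<^sub>1 + \<theta>\<^sub>1 * \<theta>\<^sub>2 + \<theta>\<^sub>2)"
    using degree_quadratic(2) assms(1) by simp
  moreover from this have nz: "\<theta>\<^sub>0 - \<theta>\<^sub>1 + \<theta>\<^sub>1 * \<theta>\<^sub>2 + \<theta>\<^sub>2 \<noteq> 0" using assms(2) by auto
  moreover from n nz have "n = (\<theta>\<^sub>0 - \<theta>\<^sub>1)\<^sup>2 / (\<theta>\<^sub>0 - \<theta>\<^sub>1 + \<theta>\<^sub>1 * \<theta>\<^sub>2 + \<theta>\<^sub>2)" by simp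
  \<comment> \<open>Equation \<open>n\<close> is quadratic in
    \<open>\<theta>\<^sub>0 - \<theta>\<^sub>1\<close>; the left side here is its discriminant,
    hence a square.\<close>
  moreover have E: "n * (n + 4 * \<theta>\<^sub>2 * (\<theta>\<^sub>1 + 1)) = (2 * (\<theta>\<^sub>0 - \<theta>\<^sub>1) - n)\<^sup>2"
  proof -
    have "(2 * (\<theta>\<^sub>0 - \<theta>\<^sub>1) - n)\<^sup>2 = 4 * (\<theta>\<^sub>0 - \<theta>\<^sub>1)\<^sup>2 - 4 * n * (\<theta>\<^sub>0 - \<theta>\<^sub>1) + n * n"
      by (simp add: algebra_simps power2_eq_square)
    then show ?thesis unfolding n by (simp add: algebra_simps)
  qed
  moreover have "\<theta>\<^sub>0 = n / 2 + \<theta>\<^sub>1 + sqrt (n * (n + 4 * \<theta>\<^sub>2 * (\<theta>\<^sub>1 + 1))) / 2 \<or>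
     \<theta>\<^sub>0 = n / 2 + \<theta>\<^sub>1 - sqrt (n * (n + 4 * \<theta>\<^sub>2 * (\<theta>\<^sub>1 + 1))) / 2"
    unfolding E by (auto simp: abs_if field_simps)
  ultimately show ?thesis
    using D_nonneg valencies eigvals_eq eigval_s0 assms(1) unfolding s_def D_def by simp
qed

end
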